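(* Let $g$ be a Gårding polynomial of degree $N\ge1$ on a finite-dimensional real vector space $V$ with Gårding cone $\Gamma$ and edge $E$, let $\Gamma^*$ be the open polar, and let $g^*:\Gamma^*\to\mathbb{R}$ be the dual Gårding function with $f^*=\log g^*$. The dual gradient map $$F^*(y)=D_yf^*=D_y\log g^*,\qquad y\in\Gamma^*,$$ is the inverse of the gradient map $$F:\Gamma/E\to\Gamma^*,\qquad F(x)=D_x\log g .$$
   Context: A Gårding polynomial of degree $N$ on a finite-dimensional real vector space $V$ is a homogeneous real polynomial $g$ of degree $N$ on $V$ together with a connected component $\Gamma$ of $\{g>0\}$ (the Gårding cone) such that for some $e\in\Gamma$ and every $v\in V$ the polynomial $t\mapsto g(te+v)$ has exactly $N$ real roots counted with multiplicity. The cone $\Gamma$ is then open and convex. Its edge is the linear subspace $E=\overline\Gamma\cap(-\overline\Gamma)$, and $g(x+v)=g(x)$ for all $x\in V$, $v\in E$. The polar is $\Gamma^0=\{y\in V^*:\langle y,x\rangle\ge0\ \forall x\in\Gamma\}$. Let $S\subset V^*$ be its linear span, which is the annihilator of $E$, so that $S^*=V/E$. The open polar $\Gamma^*$ is the interior of $\Gamma^0$ relative to $S$. Derivatives at points of $\Gamma^*$ of functions on $\Gamma^*$ are therefore elements of $S^*=V/E$. $\Gamma/E$ is the image of $\Gamma$ in $V/E$. When $E=\{0\}$ this is simply $\Gamma\subset V$. For $x\in\Gamma$, $F(x)=D_x\log g\in V^*$ depends only on the class of $x$ in $\Gamma/E$, and $F$ is a bijection (indeed a diffeomorphism) $\Gamma/E\to\Gamma^*$.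 The dual Gårding function is $g^*(y)=1/g(x)$ for $y\in\Gamma^*$, where $x\in\Gamma$ is any point with $F(x)=y$; it is real analytic. *)

theory Defs
  imports "HOL-Analysis.Analysis" "HOL-Computational_Algebra.Polynomial"
begin

text \<open>
  The ambient space \<open>V\<close> is a Euclidean space \<open>'a\<close>, and its dual \<open>V\<^sup>*\<close> is the type
  \<open>'a \<Rightarrow>\<^sub>L real\<close> (in finite dimension every linear functional is bounded). The inner product
  of \<open>'a\<close> enters only through the topology; it is not used to identify \<open>V\<close> with \<open>V\<^sup>*\<close>.
\<close>

definition garding_polynomial :: "nat \<Rightarrow> ('a::euclidean_space \<Rightarrow> real) \<Rightarrow> 'a set \<Rightarrow> bool" where
  "garding_polynomial N g \<Gamma> \<longleftrightarrow>
     real_polynomial_function g \<and>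
     (\<forall>c x. g (c *\<^sub>R x) = c ^ N * g x) \<and>
     \<Gamma> \<in> components {x. 0 < g x} \<and>
     (\<exists>e\<in>\<Gamma>. \<forall>v. \<exists>p :: real poly.
        (\<forall>t. poly p t = g (t *\<^sub>R e + v)) \<and> size (proots p) = N)"

definition edge :: "'a::euclidean_space set \<Rightarrow> 'a set" where
  "edge \<Gamma> = closure \<Gamma> \<inter> uminus ` closure \<Gamma>"

definition cone_quotient :: "'a::euclidean_space set \<Rightarrow> 'a set set" where
  "cone_quotient \<Gamma> = (\<lambda>x. x +o edge \<Gamma>) ` \<Gamma>"

definition polar :: "'a::euclidean_space set \<Rightarrow> ('a \<Rightarrow>\<^sub>L real) set" where
  "polar \<Gamma> = {y. \<forall>x\<in>\<Gamma>. 0 \<le> blinfun_apply y x}"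

definition open_polar :: "'a::euclidean_space set \<Rightarrow> ('a \<Rightarrow>\<^sub>L real) set" where
  "open_polar \<Gamma> = (top_of_set (span (polar \<Gamma>))) interior_of (polar \<Gamma>)"

definition log_gradient :: "('a::euclidean_space \<Rightarrow> real) \<Rightarrow> 'a \<Rightarrow> ('a \<Rightarrow>\<^sub>L real)" where
  "log_gradient g x = Blinfun (frechet_derivative (\<lambda>z. ln (g z)) (at x))"

text \<open>
  The maps \<open>gradient_map\<close> and \<open>dual_garding\<close> are defined by choosing an arbitrary representative;
  \<open>the_elem\<close> takes the common value on all representatives (and is unspecified if there is none).
\<close>

definition gradient_map :: "('a::euclidean_space \<Rightarrow> real) \<Rightarrow> 'a set \<Rightarrow> ('a \<Rightarrow>\<^sub>L real)" where
  "gradient_map g X = the_elem (log_gradient g ` X)"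

definition dual_garding ::
    "('a::euclidean_space \<Rightarrow> real) \<Rightarrow> 'a set \<Rightarrow> ('a \<Rightarrow>\<^sub>L real) \<Rightarrow> real" where
  "dual_garding g \<Gamma> y = the_elem ((\<lambda>x. 1 / g x) ` {x \<in> \<Gamma>. log_gradient g x = y})"

text \<open>
  The open polar is open in its span \<open>S\<close>, so the derivative of \<open>ln g\<^sup>*\<close> at one of its points is an
  element of \<open>S\<^sup>* = V/E\<close>, where the class \<open>x + E\<close> acts on \<open>S\<close> by \<open>\<eta> \<mapsto> \<eta> x\<close>. The class
  representing the derivative is given below as the set of all its representatives \<open>x\<close>; this set is
  empty, hence not an element of \<open>V/E\<close>, if \<open>ln g\<^sup>*\<close> is not differentiable at \<open>y\<close>.
\<close>

definition dual_gradient_map ::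
    "('a::euclidean_space \<Rightarrow> real) \<Rightarrow> 'a set \<Rightarrow> ('a \<Rightarrow>\<^sub>L real) \<Rightarrow> 'a set" where
  "dual_gradient_map g \<Gamma> y =
     {x. ((\<lambda>\<eta>. ln (dual_garding g \<Gamma> \<eta>)) has_derivative (\<lambda>\<eta>. blinfun_apply \<eta> x))
           (at y within open_polar \<Gamma>)}"

end

theory Submission
  imports Defs "HOL-Computational_Algebra.Fundamental_Theorem_Algebra"
begin

text \<open>
  Everything rests on one algebraic fact, due to Garding: every \<open>x \<in> \<Gamma>\<close> is a hyperbolic direction,
  so that along any line through \<open>x\<close>
  \[ g(x + t v) = g(x) \prod_{i<N} (1 + t \mu_i), \qquad \mu_i \in \mathbb{R} \]
  (\<open>hyperbolic_cone\<close>, \<open>real_factorization\<close>). Taking logarithms, \<open>F(x)(v)\<close> is \<open>\<Sum>i<N. \<mu>\<^sub>i\<close>, and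
  \<open>ln (1 + \<mu>) \<le> \<mu>\<close>, with equality only for \<open>\<mu> = 0\<close>, shows that \<open>ln g\<close> is concave on \<open>\<Gamma>\<close> and strictly
  concave modulo the edge \<open>E\<close>: if all \<open>\<mu>\<^sub>i\<close> vanish then \<open>g\<close> is constant and positive on the line, the line
  stays in \<open>\<Gamma>\<close>, and \<open>v \<in> E\<close> (\<open>log_concave\<close>). Hence \<open>F\<close> is injective modulo \<open>E\<close>.

  To see that all of \<open>\<Gamma>\<close> is hyperbolic, \<open>g\<close> is extended to a complex polynomial \<open>h\<close> on \<open>V \<times> V\<close>, where
  \<open>(x, w)\<close> stands for \<open>x + \<i> w\<close>. Given one hyperbolic direction \<open>e\<close> and \<open>a \<in> \<Gamma>\<close>, the roots \<open>t\<close> of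
  \<open>h (s v + t a + \<i> \<epsilon> e)\<close> with \<open>\<epsilon> > 0\<close> are never real, since \<open>e\<close> is hyperbolic. At \<open>s = 0\<close> they are in the
  lower half plane, so they remain there up to \<open>s = 1\<close>, and \<open>\<epsilon> \<rightarrow> 0\<close> followed by complex conjugation
  makes the roots of \<open>g (v + t a)\<close> real. Applied at each point of \<open>\<Gamma>\<close>, the fact that \<open>\<Gamma>\<close> is star-shaped
  about a hyperbolic direction also shows that \<open>\<Gamma>\<close> is convex.

  On the dual side, \<open>F(x)\<close> is positive on \<open>closure \<Gamma> - E\<close>, so it lies in the relative interior of the
  polar. For \<open>y\<close> in the open polar, a maximum of \<open>g\<close> on the slice \<open>y = N\<close> of \<open>closure \<Gamma>\<close>, taken modulo
  \<open>E\<close>, is a point \<open>m \<in> \<Gamma>\<close> with \<open>F(m) = y\<close> (\<open>gradient_surjective\<close>). Finally let \<open>y = F(x)\<close> and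
  \<open>\<eta> = F(z)\<close>. Euler's identity \<open>F(x)(x) = N\<close> and two tangent inequalities for \<open>ln g\<close> place the error
  \[ \ln g^*(\eta) - \ln g^*(y) - (\eta - y)(x) \]
  between \<open>(\<eta> - y)(z - x)\<close> and \<open>0\<close>. As \<open>z\<close> can be chosen near \<open>x\<close> when \<open>\<eta>\<close> is near \<open>y\<close>
  (\<open>gradient_inverse_continuous\<close>), the class of \<open>x\<close> is the derivative of \<open>ln g\<^sup>*\<close> at \<open>F(x)\<close>, and this
  says that the dual gradient map inverts \<open>F\<close>.
\<close>

section \<open>Complexification of a real polynomial function\<close>

text \<open>
  The complexification of \<open>V\<close> is modelled on \<open>V \<times> V\<close>, the pair \<open>(x, w)\<close> standing for \<open>x + \<i> w\<close>.
\<close>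

definition cscale :: "complex \<Rightarrow> 'a::real_vector \<times> 'a \<Rightarrow> 'a \<times> 'a" where
  "cscale c z = (Re c *\<^sub>R fst z - Im c *\<^sub>R snd z, Re c *\<^sub>R snd z + Im c *\<^sub>R fst z)"

lemma cscale_of_real: "cscale (of_real r) z = r *\<^sub>R z"
  by (simp add: cscale_def prod_eq_iff)

lemma cscale_add_right: "cscale c (z + w) = cscale c z + cscale c w"
  by (simp add: cscale_def prod_eq_iff algebra_simps)

lemma cscale_cscale: "cscale c (cscale d z) = cscale (c * d) z"
  by (simp add: cscale_def prod_eq_iff algebra_simps)

lemma cscale_zero_left: "cscale 0 z = 0"
  by (simp add: cscale_def prod_eq_iff)

lemma cscale_one_left: "cscale 1 z = z"
  by (simp add: cscale_def prod_eq_iff)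

lemma continuous_on_cscale [continuous_intros]:
  fixes f :: "'b::topological_space \<Rightarrow> complex" and z :: "'b \<Rightarrow> 'a::real_normed_vector \<times> 'a"
  assumes "continuous_on S f" "continuous_on S z"
  shows "continuous_on S (\<lambda>s. cscale (f s) (z s))"
  unfolding cscale_def using assms by (intro continuous_intros)

lemma norm_cscale_le: "norm (cscale c z) \<le> 2 * norm c * norm z"
proof -
  have "cscale c z = Re c *\<^sub>R z + Im c *\<^sub>R (- snd z, fst z)"
    by (simp add: cscale_def prod_eq_iff)
  then have "norm (cscale c z) \<le> \<bar>Re c\<bar> * norm z + \<bar>Im c\<bar> * norm (- snd z, fst z)"
    by (metis norm_scaleR norm_triangle_ineq)
  also have "norm (- snd z, fst z) = norm z"
    by (simp add: norm_prod_def add.commute)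
  also have "\<bar>Re c\<bar> * norm z + \<bar>Im c\<bar> * norm z \<le> norm c * norm z + norm c * norm z"
    by (intro add_mono mult_right_mono abs_Re_le_cmod abs_Im_le_cmod) auto
  finally show ?thesis by simp
qed

text \<open>
  Only the restrictions of \<open>h\<close> to complex lines are required to be polynomials: all later arguments
  concern roots along such a line, and this property passes at once to sums and products.
\<close>

definition complex_extension :: "('a::real_normed_vector \<Rightarrow> real) \<Rightarrow> ('a \<times> 'a \<Rightarrow> complex) \<Rightarrow> bool" where
  "complex_extension g h \<longleftrightarrow>
     (\<forall>x. h (x, 0) = of_real (g x)) \<and> continuous_on UNIV h \<and>
     (\<forall>x w. h (x, - w) = cnj (h (x, w))) \<and>
     (\<forall>z d. \<exists>p. \<forall>t. h (z + cscale t d) = poly p t)"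

lemma complex_extension_exists:
  assumes "real_polynomial_function g"
  shows "\<exists>h. complex_extension g h"
  using assms
proof (induction rule: real_polynomial_function.induct)
  case (linear f)
  interpret bounded_linear f by fact
  define h where "h = (\<lambda>z. Complex (f (fst z)) (f (snd z)))"
  have "continuous_on UNIV h"
    unfolding h_def complex_eq
    by (intro continuous_intros continuous_on)
  moreover have "h (z + cscale t d) = poly [:h z, h d:] t" for z d t
    by (simp add: h_def complex_eq_iff cscale_def add diff scale)
  ultimately show ?case
    unfolding complex_extension_def
    by (intro exI[of _ h]) (auto simp: h_def complex_eq_iff zero neg simp del: poly_pCons)
next
  case (const c)
  have "\<exists>p. \<forall>t. of_real c = poly p (t::complex)"
    by (rule exI[of _ "[:of_real c:]"]) simp
  then show ?case
    unfolding complex_extension_def by (intro exI[of _ "\<lambda>_. of_real c"]) auto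
next
  case (add f g)
  then obtain h k where hk: "complex_extension f h" "complex_extension g k" by blast
  have "\<exists>p. \<forall>t. h (z + cscale t d) + k (z + cscale t d) = poly p t" for z d
    using hk unfolding complex_extension_def by (metis poly_add)
  with hk show ?case
    unfolding complex_extension_def
    by (intro exI[of _ "\<lambda>z. h z + k z"]) (auto intro!: continuous_intros)
next
  case (mult f g)
  then obtain h k where hk: "complex_extension f h" "complex_extension g k" by blast
  have "\<exists>p. \<forall>t. h (z + cscale t d) * k (z + cscale t d) = poly p t" for z d
    using hk unfolding complex_extension_def by (metis poly_mult)
  with hk show ?case
    unfolding complex_extension_def
    by (intro exI[of _ "\<lambda>z. h z * k z"]) (auto intro!: continuous_intros)
qed

lemma complex_poly_eqI_real:
  fixes p q :: "complex poly"
  assumes "\<And>r::real. poly p (of_real r) = poly q (of_real r)"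
  shows "p = q"
proof (rule ccontr)
  assume "p \<noteq> q"
  then have "finite {x. poly (p - q) x = 0}"
    by (intro poly_roots_finite) simp
  moreover have "range complex_of_real \<subseteq> {x. poly (p - q) x = 0}"
    using assms by auto
  ultimately have "finite (range complex_of_real)"
    by (rule rev_finite_subset)
  then show False
    using finite_imageD[of complex_of_real UNIV] infinite_UNIV_char_0 by (auto simp: inj_def)
qed

section \<open>Roots of univariate polynomials\<close>

text \<open>
  A factorized polynomial is bounded below by \<open>|lead_coeff p| \<cdot> \<delta> ^ N\<close> at distance \<open>\<delta>\<close> from all its roots.
  This replaces the continuous dependence of roots on the coefficients: a root of one polynomial
  forces a nearby root of every polynomial close to it, provided the degree does not drop.
\<close>

lemma root_near_small_value:
  fixes p :: "complex poly"
  assumes "degree p = N" "1 \<le> N" "lead_coeff p \<noteq> 0" "norm (poly p t) < norm (lead_coeff p) * \<delta> ^ N" "0 < \<delta>"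
  shows "\<exists>r. poly p r = 0 \<and> dist r t < \<delta>"
proof (rule ccontr)
  assume neg: "\<not> ?thesis"
  obtain A where A: "size A = degree p" "p = smult (lead_coeff p) (\<Prod>x\<in>#A. [:-x, 1:])"
    using alg_closed_imp_factorization[of p] assms by fastforce
  have root: "poly p r = 0" if "r \<in># A" for r
    using that by (subst A(2)) (auto simp: poly_prod_mset)
  then have far: "\<delta> \<le> norm (t - r)" if "r \<in># A" for r
    using neg that by (force simp: dist_norm norm_minus_commute not_less)
  have "\<delta> ^ size B \<le> norm (\<Prod>r\<in>#B. t - r)" if "B \<subseteq># A" for B
    using that
  proof (induction B)
    case (add r B)
    then have "r \<in># A" "B \<subseteq># A" by (auto dest: mset_subset_eq_insertD intro: subset_mset.less_imp_le)
    then show ?case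
      using add.IH far[of r] \<open>0 < \<delta>\<close> by (auto simp: norm_mult intro!: mult_mono)
  qed simp
  from this[of A] have "\<delta> ^ N \<le> norm (\<Prod>r\<in>#A. t - r)"
    using A assms by simp
  moreover have "poly p t = lead_coeff p * (\<Prod>r\<in>#A. t - r)"
    by (subst A(2)) (simp add: poly_prod_mset)
  ultimately show False
    using assms by (simp add: norm_mult)
qed

lemma splits_if_size_proots:
  fixes p :: "'a::field poly"
  assumes "size (proots p) = degree p"
  shows "p = smult (lead_coeff p) (\<Prod>r\<in>#proots p. [:-r, 1:])"
  using assms
proof (induction "degree p" arbitrary: p)
  case 0
  then show ?case by (auto elim: degree_eq_zeroE)
next
  case (Suc n)
  then have "proots p \<noteq> {#}" "p \<noteq> 0" by auto
  then obtain r where "poly p r = 0" by (metis multiset_nonemptyE set_count_proots mem_Collect_eq)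
  then obtain q where q: "p = [:-r, 1:] * q" by (metis dvdE poly_eq_0_iff_dvd)
  with \<open>p \<noteq> 0\<close> have "q \<noteq> 0" by auto
  then have pr: "proots p = {#r#} + proots q" and dg: "degree p = Suc (degree q)"
    unfolding q by (simp_all add: proots_mult degree_mult_eq del: mult_pCons_left)
  with Suc have "q = smult (lead_coeff q) (\<Prod>r\<in>#proots q. [:-r, 1:])" by simp
  then have "p = [:-r, 1:] * smult (lead_coeff q) (\<Prod>r\<in>#proots q. [:-r, 1:])"
    using q by simp
  also have "\<dots> = smult (lead_coeff q) (\<Prod>r\<in>#proots p. [:-r, 1:])"
    by (simp add: pr del: mult_pCons_left)
  also have "lead_coeff q = lead_coeff p"
    using q pr by (simp add: lead_coeff_mult del: mult_pCons_left)
  finally show ?case .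
qed

lemma of_real_prod_mset: "of_real (\<Prod>r\<in>#A. f r) = (\<Prod>r\<in>#A. complex_of_real (f r))"
  by (induction A) auto

section \<open>Homogeneous forms and hyperbolic directions\<close>

locale complexified_form =
  fixes g :: "'a::euclidean_space \<Rightarrow> real" and h :: "'a \<times> 'a \<Rightarrow> complex" and N :: nat
  assumes ext: "complex_extension g h"
    and homogeneous: "g (c *\<^sub>R x) = c ^ N * g x"
    and degree_pos: "1 \<le> N"
begin

lemma h_real: "h (x, 0) = of_real (g x)"
  and h_cnj: "h (x, - w) = cnj (h (x, w))"
  and h_line: "\<exists>p. \<forall>t. h (z + cscale t d) = poly p t"
  using ext unfolding complex_extension_def by blast+

lemma continuous_on_h: "continuous_on S f \<Longrightarrow> continuous_on S (\<lambda>s. h (f s))"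
  using ext unfolding complex_extension_def
  by (metis continuous_on_compose2 subset_UNIV)

lemma continuous_on_g: "continuous_on S f \<Longrightarrow> continuous_on S (\<lambda>s. g (f s))"
  using continuous_on_Re[OF continuous_on_h[OF continuous_on_Pair[OF _ continuous_on_const[of _ 0]]], of S f]
  by (simp add: h_real)

text \<open>
  Both sides are polynomials in the complex parameter \<open>\<tau>\<close> of the line \<open>x + \<tau> w\<close>, and they agree for real
  \<open>\<tau>\<close>; the value at \<open>\<tau> = \<i>\<close> is the assertion for \<open>(x, w)\<close>.
\<close>

lemma h_homogeneous_real: "h (r *\<^sub>R z) = of_real r ^ N * h z"
proof -
  obtain x w where z: "z = (x, w)" by force
  obtain p where p: "\<And>t. h ((x, 0) + cscale t (w, 0)) = poly p t" using h_line by blast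
  obtain q where q: "\<And>t. h ((r *\<^sub>R x, 0) + cscale t (r *\<^sub>R w, 0)) = poly q t" using h_line by blast
  have "q = smult (of_real r ^ N) p"
  proof (rule complex_poly_eqI_real)
    fix s :: real
    have "poly q (of_real s) = h (r *\<^sub>R (x + s *\<^sub>R w), 0)"
      by (simp add: q[symmetric] cscale_of_real algebra_simps)
    also have "\<dots> = of_real r ^ N * h (x + s *\<^sub>R w, 0)"
      by (simp add: h_real homogeneous)
    also have "\<dots> = poly (smult (of_real r ^ N) p) (of_real s)"
      by (simp add: p[symmetric] cscale_of_real)
    finally show "poly q (of_real s) = poly (smult (of_real r ^ N) p) (of_real s)" .
  qed
  then have "poly q \<i> = of_real r ^ N * poly p \<i>" by simp
  then show ?thesis
    by (simp add: q[symmetric] p[symmetric] cscale_def z)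
qed

lemma h_homogeneous: "h (cscale c z) = c ^ N * h z"
proof -
  obtain p where p: "\<And>t. h (0 + cscale t z) = poly p t" using h_line by blast
  have "p = monom (h z) N"
  proof (rule complex_poly_eqI_real)
    fix r :: real
    show "poly p (of_real r) = poly (monom (h z) N) (of_real r)"
      using h_homogeneous_real[of r z]
      by (simp add: p[symmetric] cscale_of_real poly_monom mult.commute)
  qed
  then show ?thesis
    using p[of c] by (simp add: poly_monom mult.commute)
qed

text \<open>
  By homogeneity \<open>h (z + t d) = t ^ N * h (d + z / t)\<close>, so the polynomial along direction \<open>d\<close> is the
  reversal of the polynomial of the line through \<open>d\<close> in direction \<open>z\<close>, whose constant term is \<open>g d\<close>.
  The degree is therefore \<open>N\<close> for every base point \<open>z\<close>, which keeps roots from escaping to infinity.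
\<close>

lemma h_line_degree:
  assumes "g d \<noteq> 0"
  shows "\<exists>p. degree p = N \<and> lead_coeff p = of_real (g d) \<and> (\<forall>t. h (z + cscale t (d, 0)) = poly p t)"
proof -
  obtain p where p: "\<And>t. h (z + cscale t (d, 0)) = poly p t" using h_line by blast
  obtain q where q: "\<And>t. h ((d, 0) + cscale t z) = poly q t" using h_line by blast
  have q0: "coeff q 0 = of_real (g d)"
    using q[of 0] by (simp add: cscale_zero_left h_real poly_0_coeff_0)
  have eq: "poly (monom 1 (degree q) * p) t = poly (monom 1 N * reflect_poly q) t" if "t \<noteq> 0" for t
  proof -
    have "h (z + cscale t (d, 0)) = h (cscale t ((d, 0) + cscale (inverse t) z))"
      using that by (simp add: cscale_add_right cscale_cscale cscale_one_left add.commute)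
    then have "poly p t = t ^ N * poly q (inverse t)"
      by (simp add: p q h_homogeneous)
    then show ?thesis
      using that by (simp add: poly_monom poly_reflect_poly_nz)
  qed
  \<comment> \<open>a power of \<open>t\<close> on either side clears the denominators; the identity holds for infinitely many \<open>t\<close>\<close>
  have "monom 1 (degree q) * p = monom 1 N * reflect_poly q"
  proof (rule ccontr)
    assume "\<not> ?thesis"
    then have "finite {t. poly (monom 1 (degree q) * p - monom 1 N * reflect_poly q) t = 0}"
      by (intro poly_roots_finite) simp
    moreover have "UNIV - {0} \<subseteq> {t. poly (monom 1 (degree q) * p - monom 1 N * reflect_poly q) t = 0}"
      using eq by auto
    ultimately have "finite (UNIV - {0::complex})" by (rule rev_finite_subset)
    then show False using infinite_UNIV_char_0[where 'a = complex] by simp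
  qed
  note E = this
  have nz: "reflect_poly q \<noteq> 0" "q \<noteq> 0" using q0 assms by auto
  then have "p \<noteq> 0" using E by auto
  have "degree q + degree p = N + degree (reflect_poly q)"
    using arg_cong[OF E, of degree] nz \<open>p \<noteq> 0\<close> by (simp add: degree_mult_eq degree_monom_eq)
  then have "degree p = N" using q0 assms by simp
  moreover have "lead_coeff p = lead_coeff (reflect_poly q)"
    using arg_cong[OF E, of lead_coeff] by (simp add: lead_coeff_mult degree_monom_eq)
  then have "lead_coeff p = of_real (g d)"
    using q0 assms by (simp add: coeff_reflect_poly poly_0_coeff_0)
  ultimately show ?thesis using p by blast
qed

text \<open>
  Having \<open>N\<close> real roots with multiplicity means that no complex root is nonreal; this form survives
  perturbation arguments, which track single roots.
\<close>

definition hyperbolic :: "'a \<Rightarrow> bool" where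
  "hyperbolic e \<longleftrightarrow> 0 < g e \<and> (\<forall>v t. h ((v, 0) + cscale t (e, 0)) = 0 \<longrightarrow> Im t = 0)"

text \<open>
  The polynomial along \<open>e\<close> has degree \<open>N\<close>, so its \<open>N\<close> real roots give a complete factorization into
  linear factors, which remains valid for its complex extension.
\<close>

lemma hyperbolicI_real_roots:
  assumes "0 < g e"
    and "\<And>v. \<exists>p :: real poly. (\<forall>t. poly p t = g (t *\<^sub>R e + v)) \<and> size (proots p) = N"
  shows "hyperbolic e"
  unfolding hyperbolic_def
proof (intro conjI allI impI)
  fix v t assume root: "h ((v, 0) + cscale t (e, 0)) = 0"
  obtain p :: "real poly" where p: "\<And>t. poly p t = g (t *\<^sub>R e + v)" "size (proots p) = N"
    using assms(2) by blast
  obtain P where P: "degree P = N" "lead_coeff P = of_real (g e)"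
    "\<And>t. h ((v, 0) + cscale t (e, 0)) = poly P t"
    using h_line_degree[of e] assms(1) by (metis less_irrefl)
  have poly_of_real: "poly (map_poly complex_of_real p) (of_real s) = of_real (poly p s)" for p s
    by (induction p) (auto simp: map_poly_pCons)
  have Pp: "P = map_poly of_real p"
    by (rule complex_poly_eqI_real)
      (simp add: poly_of_real P(3)[symmetric] p cscale_of_real h_real add.commute)
  then have deg: "degree p = N" using P(1) by (simp add: degree_map_poly)
  have "p = smult (lead_coeff p) (\<Prod>r\<in>#proots p. [:-r, 1:])"
    using deg p(2) by (intro splits_if_size_proots) simp
  note split = this
  have "P = smult (of_real (lead_coeff p)) (\<Prod>r\<in>#proots p. [:-of_real r, 1:])"
  proof (rule complex_poly_eqI_real)
    fix s :: real
    have "poly P (of_real s) = of_real (poly p s)"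
      by (simp add: Pp poly_of_real)
    also have "poly p s = lead_coeff p * (\<Prod>r\<in>#proots p. s - r)"
      by (subst split) (simp add: poly_prod_mset)
    finally show "poly P (of_real s) =
        poly (smult (of_real (lead_coeff p)) (\<Prod>r\<in>#proots p. [:-of_real r, 1:])) (of_real s)"
      by (simp add: poly_prod_mset of_real_prod_mset)
  qed
  moreover have "poly P t = 0" using root P(3) by simp
  moreover have "lead_coeff p \<noteq> 0" using deg degree_pos by auto
  ultimately have "(\<Prod>r\<in>#proots p. t - of_real r) = 0"
    by (simp add: poly_prod_mset)
  then show "Im t = 0" by auto
qed fact

lemma open_positive: "open {x. 0 < g x}"
  by (intro open_Collect_less continuous_on_g continuous_intros)

lemma positive_segment_iff:
  "closed_segment x e \<subseteq> {x. 0 < g x} \<longleftrightarrow> 0 < g e \<and> (\<forall>\<tau>\<ge>0. 0 < g (x + \<tau> *\<^sub>R e))"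
proof safe
  assume seg: "closed_segment x e \<subseteq> {x. 0 < g x}"
  then show "0 < g e" by auto
  fix \<tau> :: real assume "0 \<le> \<tau>"
  have "(1 - \<tau> / (1 + \<tau>)) *\<^sub>R x + (\<tau> / (1 + \<tau>)) *\<^sub>R e \<in> closed_segment x e"
    using \<open>0 \<le> \<tau>\<close> unfolding closed_segment_def by (intro CollectI exI[of _ "\<tau> / (1 + \<tau>)"]) simp
  then have "0 < g ((1 - \<tau> / (1 + \<tau>)) *\<^sub>R x + (\<tau> / (1 + \<tau>)) *\<^sub>R e)" using seg by auto
  moreover have "(1 - \<tau> / (1 + \<tau>)) *\<^sub>R x + (\<tau> / (1 + \<tau>)) *\<^sub>R e = (1 / (1 + \<tau>)) *\<^sub>R (x + \<tau> *\<^sub>R e)"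
    using \<open>0 \<le> \<tau>\<close> by (simp add: scaleR_add_right field_simps)
  ultimately show "0 < g (x + \<tau> *\<^sub>R e)"
    using \<open>0 \<le> \<tau>\<close> by (simp only: homogeneous) (simp add: zero_less_mult_iff)
next
  fix y assume e: "0 < g e" and ray: "\<forall>\<tau>\<ge>0. 0 < g (x + \<tau> *\<^sub>R e)" and "y \<in> closed_segment x e"
  then obtain u where u: "0 \<le> u" "u \<le> 1" "y = (1 - u) *\<^sub>R x + u *\<^sub>R e"
    by (auto simp: closed_segment_def)
  show "0 < g y"
  proof (cases "u = 1")
    case False
    then have "y = (1 - u) *\<^sub>R (x + (u / (1 - u)) *\<^sub>R e)"
      using u by (simp add: scaleR_add_right)
    moreover have "0 < g (x + (u / (1 - u)) *\<^sub>R e)" using ray u by simp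
    ultimately show ?thesis using u False by (simp add: homogeneous)
  qed (use u e in auto)
qed

text \<open>
  Among the points with \<open>g > 0\<close>, those whose segment to \<open>e\<close> stays in \<open>{g > 0}\<close> form an open set, by
  compactness of the segment. The others form an open set too: their ray in direction \<open>e\<close> meets a
  root of \<open>g\<close>, a nearby ray has a root near it, and hyperbolicity makes that root real. A connected
  component lies in only one of the two sets.
\<close>

lemma component_star_shaped:
  assumes "hyperbolic e" "\<Gamma> \<in> components {x. 0 < g x}" "e \<in> \<Gamma>" "a \<in> \<Gamma>"
  shows "closed_segment a e \<subseteq> {x. 0 < g x}"
proof -
  define U where "U = {x. 0 < g x}"
  define A where "A = {x. closed_segment x e \<subseteq> U}"
  have e: "0 < g e" using assms(1) by (simp add: hyperbolic_def)
  have "open U" using open_positive by (simp add: U_def)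
  have "open A"
    unfolding open_dist
  proof
    fix x assume "x \<in> A"
    then obtain \<epsilon> where \<epsilon>: "0 < \<epsilon>" "(\<Union>y\<in>closed_segment x e. ball y \<epsilon>) \<subseteq> U"
      using compact_subset_open_imp_ball_epsilon_subset[OF compact_segment \<open>open U\<close>, of x e]
      unfolding A_def by auto
    have "x' \<in> A" if "dist x' x < \<epsilon>" for x'
      unfolding A_def
    proof safe
      fix y assume "y \<in> closed_segment x' e"
      then obtain u where u: "0 \<le> u" "u \<le> 1" "y = (1 - u) *\<^sub>R x' + u *\<^sub>R e"
        by (auto simp: closed_segment_def)
      define y' where "y' = (1 - u) *\<^sub>R x + u *\<^sub>R e"
      have "y' \<in> closed_segment x e" using u by (auto simp: closed_segment_def y'_def)
      moreover have "y' - y = (1 - u) *\<^sub>R (x - x')"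
        by (simp add: u y'_def algebra_simps)
      then have "dist y' y = (1 - u) * dist x' x"
        using u by (simp add: dist_norm norm_minus_commute)
      then have "dist y' y < \<epsilon>"
        using that u mult_left_le_one_le[of "dist x' x" "1 - u"] by auto
      ultimately show "y \<in> U" using \<epsilon>(2) by (meson UN_subset_iff mem_ball subsetD)
    qed
    then show "\<exists>\<epsilon>>0. \<forall>x'. dist x' x < \<epsilon> \<longrightarrow> x' \<in> A" using \<epsilon> by blast
  qed
  have "open (U - A)"
    unfolding open_dist
  proof
    fix x assume x: "x \<in> U - A"
    then obtain \<tau>0 where \<tau>0: "0 \<le> \<tau>0" "g (x + \<tau>0 *\<^sub>R e) \<le> 0"
      using e positive_segment_iff[of x e] by (auto simp: A_def U_def not_less)
    have "0 \<le> g (x + 0 *\<^sub>R e)" using x by (simp add: U_def)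
    moreover have "continuous_on {0..\<tau>0} (\<lambda>\<tau>. g (x + \<tau> *\<^sub>R e))"
      by (intro continuous_on_g continuous_intros)
    ultimately obtain \<tau> where \<tau>: "0 \<le> \<tau>" "g (x + \<tau> *\<^sub>R e) = 0"
      using IVT2'[of "\<lambda>\<tau>. g (x + \<tau> *\<^sub>R e)" \<tau>0 0 0] \<tau>0 by auto
    then have "0 < \<tau>" using x by (cases "\<tau> = 0") (auto simp: U_def)
    \<comment> \<open>where \<open>f > 0\<close>, there is a root within distance \<open>\<tau>\<close> of \<open>\<tau>\<close>, hence with positive real part\<close>
    define f where "f = (\<lambda>x'. g e * \<tau> ^ N - norm (h ((x', 0) + cscale (of_real \<tau>) (e, 0))))"
    have "continuous_on UNIV f"
      unfolding f_def by (intro continuous_on_h continuous_intros)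
    then have "open (f -` {0<..})"
      by (intro open_vimage) auto
    moreover have "0 < f x"
      using \<tau> \<open>0 < \<tau>\<close> e by (simp add: f_def cscale_of_real h_real)
    ultimately obtain \<epsilon> where \<epsilon>: "0 < \<epsilon>" "\<And>x'. dist x' x < \<epsilon> \<Longrightarrow> 0 < f x'"
      unfolding open_dist by (metis greaterThan_iff vimageE vimageI)
    have "x' \<notin> A" if "0 < f x'" for x'
    proof
      assume "x' \<in> A"
      obtain p where p: "degree p = N" "lead_coeff p = of_real (g e)"
        "\<And>t. h ((x', 0) + cscale t (e, 0)) = poly p t"
        using h_line_degree[of e] e by (metis less_irrefl)
      have "norm (poly p (of_real \<tau>)) < norm (lead_coeff p) * \<tau> ^ N"
        using that e unfolding p(2) by (simp add: f_def p(3))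
      then obtain r where r: "poly p r = 0" "dist r (of_real \<tau>) < \<tau>"
        using root_near_small_value[of p N "of_real \<tau>" \<tau>] p degree_pos e \<open>0 < \<tau>\<close> by auto
      then have "Im r = 0" using assms(1) p(3) by (metis hyperbolic_def)
      then have real: "r = of_real (Re r)" by (simp add: complex_eq_iff)
      have "\<bar>Re r - \<tau>\<bar> < \<tau>"
        using r(2) abs_Re_le_cmod[of "r - of_real \<tau>"] by (simp add: dist_norm)
      then have "0 \<le> Re r" by linarith
      moreover have "h ((x', 0) + cscale (of_real (Re r)) (e, 0)) = 0"
        using r(1) p(3) real by simp
      then have "g (x' + Re r *\<^sub>R e) = 0"
        by (simp add: cscale_of_real h_real)
      ultimately show False
        using \<open>x' \<in> A\<close> positive_segment_iff[of x' e] by (force simp: A_def U_def)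
    qed
    moreover obtain \<epsilon>' where "0 < \<epsilon>'" "\<And>x'. dist x' x < \<epsilon>' \<Longrightarrow> x' \<in> U"
      using \<open>open U\<close> x unfolding open_dist by blast
    ultimately show "\<exists>\<epsilon>>0. \<forall>x'. dist x' x < \<epsilon> \<longrightarrow> x' \<in> U - A"
      using \<epsilon> by (intro exI[of _ "min \<epsilon> \<epsilon>'"]) auto
  qed
  have "A \<inter> (U - A) \<inter> \<Gamma> = {}" "\<Gamma> \<subseteq> A \<union> (U - A)"
    using in_components_subset[OF assms(2)] by (auto simp: U_def)
  with \<open>open A\<close> \<open>open (U - A)\<close> have "A \<inter> \<Gamma> = {} \<or> (U - A) \<inter> \<Gamma> = {}"
    using in_components_connected[OF assms(2)] connectedD by blast
  moreover have "e \<in> A" using e by (simp add: A_def U_def)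
  ultimately have "a \<in> A"
    using assms in_components_subset[OF assms(2)] by (auto simp: U_def)
  then show ?thesis by (simp add: A_def U_def)
qed

text \<open>
  The homotopy \<open>H (s, t) = h (s v + t a + \<i> \<epsilon> e)\<close> never has a real root \<open>t\<close>, since \<open>\<i> \<epsilon>\<close> would be a nonreal
  root in the hyperbolic direction \<open>e\<close>. The set of \<open>s \<in> [0, 1]\<close> for which there is a root with
  \<open>Im t \<ge> 0\<close> is closed, because roots are bounded, and open, because such a root lies strictly above
  the real axis and persists nearby. It does not contain \<open>0\<close>, where the roots are \<open>\<i> \<epsilon> / \<rho>\<close> for the
  roots \<open>\<rho> < 0\<close> of \<open>g (a + \<rho> e)\<close>. So it is empty.
\<close>

lemma no_roots_upper_half_plane:
  assumes "hyperbolic e" "\<And>\<tau>. 0 \<le> \<tau> \<Longrightarrow> 0 < g (a + \<tau> *\<^sub>R e)" "0 < \<epsilon>" "0 \<le> Im t"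
  shows "h ((v, \<epsilon> *\<^sub>R e) + cscale t (a, 0)) \<noteq> 0"
proof -
  define H where "H = (\<lambda>(s, t). h ((s *\<^sub>R v, \<epsilon> *\<^sub>R e) + cscale t (a, 0)))"
  have contH: "continuous_on S (\<lambda>x. H (f x, k x))" if "continuous_on S f" "continuous_on S k"
    for S and f k :: "'b::topological_space \<Rightarrow> _"
    unfolding H_def prod.case by (intro continuous_on_h continuous_intros that)
  have a: "0 < g a" using assms(2)[of 0] by simp
  have no_real: "H (s, t) \<noteq> 0" if "Im t = 0" for s t
  proof
    assume "H (s, t) = 0"
    moreover have "(s *\<^sub>R v, \<epsilon> *\<^sub>R e) + cscale t (a, 0) =
        (s *\<^sub>R v + Re t *\<^sub>R a, 0) + cscale (\<i> * of_real \<epsilon>) (e, 0)"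
      using that by (simp add: cscale_def)
    ultimately have "Im (\<i> * of_real \<epsilon>) = 0"
      using assms(1) by (simp only: H_def prod.case hyperbolic_def)
    then show False using \<open>0 < \<epsilon>\<close> by simp
  qed
  have start: "H (0, t) \<noteq> 0" if "0 \<le> Im t" for t
  proof
    assume root: "H (0, t) = 0"
    then have "0 < Im t" using no_real that by (metis order_le_less)
    then have "t \<noteq> 0" by auto
    \<comment> \<open>dividing \<open>t a + \<i> \<epsilon> e\<close> by \<open>t\<close> turns the root into one of \<open>g (a + \<rho> e)\<close>\<close>
    define \<rho> where "\<rho> = \<i> * of_real \<epsilon> / t"
    have "(0, \<epsilon> *\<^sub>R e) + cscale t (a, 0) = cscale (t * \<rho>) (e, 0) + cscale t (a, 0)"
      using \<open>t \<noteq> 0\<close> by (simp add: \<rho>_def) (simp add: cscale_def)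
    also have "\<dots> = cscale t ((a, 0) + cscale \<rho> (e, 0))"
      by (simp add: cscale_add_right cscale_cscale)
    finally have "h ((a, 0) + cscale \<rho> (e, 0)) = 0"
      using root \<open>t \<noteq> 0\<close> by (simp add: H_def h_homogeneous zero_prod_def)
    moreover from this have "Im \<rho> = 0" using assms(1) by (simp add: hyperbolic_def)
    then have \<rho>: "\<rho> = of_real (Re \<rho>)" by (simp add: complex_eq_iff)
    ultimately have "h ((a, 0) + cscale (of_real (Re \<rho>)) (e, 0)) = 0" by simp
    then have "g (a + Re \<rho> *\<^sub>R e) = 0" by (simp add: cscale_of_real h_real)
    then have "Re \<rho> < 0" using assms(2)[of "Re \<rho>"] by force
    have "of_real (Re \<rho>) * t = \<i> * of_real \<epsilon>"
      using \<open>t \<noteq> 0\<close> \<rho> by (metis \<rho>_def nonzero_divide_eq_eq)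
    then have "Im (of_real (Re \<rho>) * t) = \<epsilon>" by simp
    then have "Re \<rho> * Im t = \<epsilon>" by simp
    then show False using \<open>Re \<rho> < 0\<close> \<open>0 < Im t\<close> \<open>0 < \<epsilon>\<close> by (smt (verit) mult_neg_pos)
  qed
  \<comment> \<open>a root of large modulus would, after division by \<open>t\<close>, be a zero of \<open>h\<close> close to \<open>(a, 0)\<close>\<close>
  obtain R where R: "\<And>s t. s \<in> {0..1} \<Longrightarrow> H (s, t) = 0 \<Longrightarrow> norm t \<le> R"
  proof -
    have "open {z. h z \<noteq> 0}" by (intro open_Collect_neq continuous_on_h continuous_intros)
    moreover have "(a, 0) \<in> {z. h z \<noteq> 0}" using a by (simp add: h_real)
    ultimately obtain \<delta> where \<delta>: "0 < \<delta>" "\<And>z. dist z (a, 0) < \<delta> \<Longrightarrow> h z \<noteq> 0"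
      unfolding open_dist by blast
    define M where "M = norm v + \<epsilon> * norm e + 1"
    have "0 < M" using \<open>0 < \<epsilon>\<close> by (simp add: M_def add_nonneg_pos)
    have "norm t \<le> 2 * M / \<delta>" if "s \<in> {0..1}" "H (s, t) = 0" for s t
    proof (rule ccontr)
      assume "\<not> ?thesis"
      then have big: "2 * M / \<delta> < norm t" by simp
      moreover have "0 < 2 * M / \<delta>" using \<open>0 < M\<close> \<delta> by simp
      ultimately have "t \<noteq> 0" by auto
      define z where "z = (s *\<^sub>R v, \<epsilon> *\<^sub>R e)"
      have "norm z \<le> norm (s *\<^sub>R v) + norm (\<epsilon> *\<^sub>R e)"
        unfolding z_def by (rule norm_Pair_le)
      also have "\<dots> \<le> M"
        using that \<open>0 < \<epsilon>\<close> mult_left_le_one_le[of "norm v" s] by (simp add: M_def)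
      finally have "norm z \<le> M" .
      have "norm (cscale (inverse t) z) \<le> 2 * norm (inverse t) * norm z"
        by (rule norm_cscale_le)
      also have "\<dots> \<le> 2 * norm (inverse t) * M"
        using \<open>norm z \<le> M\<close> by (intro mult_left_mono) auto
      also have "\<dots> < \<delta>"
      proof -
        have "2 * M < \<delta> * norm t"
          using big \<open>0 < \<delta>\<close> by (simp add: pos_divide_less_eq mult.commute)
        then have "2 * M / norm t < \<delta>"
          using \<open>t \<noteq> 0\<close> by (simp add: pos_divide_less_eq)
        then show ?thesis by (simp add: norm_inverse divide_inverse mult_ac)
      qed
      finally have "h ((a, 0) + cscale (inverse t) z) \<noteq> 0"
        by (intro \<delta>) (simp add: dist_norm)
      moreover have "z + cscale t (a, 0) = cscale t ((a, 0) + cscale (inverse t) z)"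
        using \<open>t \<noteq> 0\<close> by (simp add: cscale_add_right cscale_cscale cscale_one_left add.commute)
      ultimately show False using that \<open>t \<noteq> 0\<close> by (simp add: H_def z_def h_homogeneous)
    qed
    then show thesis using that by blast
  qed
  define B where "B = {s\<in>{0..1}. \<exists>t. 0 \<le> Im t \<and> H (s, t) = 0}"
  have "closed B"
  proof -
    define K where "K = ({0..1} \<times> cball 0 R) \<inter> {x. 0 \<le> Im (snd x) \<and> H (fst x, snd x) = 0}"
    have "closed {x :: real \<times> complex. 0 \<le> Im (snd x)}" "closed {x. H (fst x, snd x) = 0}"
      by (intro closed_Collect_le closed_Collect_eq contH continuous_intros)+
    then have "compact K"
      unfolding K_def by (intro compact_Int_closed compact_Times) (auto simp: Collect_conj_eq)
    moreover have "B = fst ` K"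
      using R by (force simp: B_def K_def image_iff)
    ultimately show ?thesis
      using compact_continuous_image[OF continuous_on_fst[OF continuous_on_id], of K] compact_imp_closed
      by metis
  qed
  have "openin (top_of_set {0..1}) B"
    unfolding openin_euclidean_subtopology_iff
  proof safe
    fix s0 assume "s0 \<in> B"
    then obtain t0 where t0: "H (s0, t0) = 0" "0 < Im t0"
      using no_real by (force simp: B_def order_le_less)
    \<comment> \<open>where \<open>f > 0\<close>, there is a root within distance \<open>Im t0\<close> of \<open>t0\<close>, hence in the upper half plane\<close>
    define f where "f = (\<lambda>s. g a * Im t0 ^ N - norm (H (s, t0)))"
    have "continuous_on UNIV f" unfolding f_def by (intro contH continuous_intros)
    then have "open (f -` {0<..})" by (intro open_vimage) auto
    moreover have "0 < f s0" using t0 a by (simp add: f_def)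
    ultimately obtain \<epsilon>' where \<epsilon>': "0 < \<epsilon>'" "\<And>s. dist s s0 < \<epsilon>' \<Longrightarrow> 0 < f s"
      unfolding open_dist by (metis greaterThan_iff vimageE vimageI)
    have "s \<in> B" if "s \<in> {0..1}" "0 < f s" for s
    proof -
      obtain p where p: "degree p = N" "lead_coeff p = of_real (g a)" "\<And>t. H (s, t) = poly p t"
        using h_line_degree[of a "(s *\<^sub>R v, \<epsilon> *\<^sub>R e)"] a unfolding H_def prod.case by (metis less_irrefl)
      have "norm (poly p t0) < norm (lead_coeff p) * Im t0 ^ N"
        using that a unfolding p(2) by (simp add: f_def p(3))
      then obtain r where r: "poly p r = 0" "dist r t0 < Im t0"
        using root_near_small_value[of p N t0 "Im t0"] p degree_pos a t0 by auto
      then have "\<bar>Im r - Im t0\<bar> < Im t0"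
        using abs_Im_le_cmod[of "r - t0"] by (simp add: dist_norm)
      then show ?thesis using r(1) p(3) that(1) by (auto simp: B_def intro!: exI[of _ r])
    qed
    then show "\<exists>\<epsilon>'>0. \<forall>s\<in>{0..1}. dist s s0 < \<epsilon>' \<longrightarrow> s \<in> B" using \<epsilon>' by blast
  qed (auto simp: B_def)
  moreover have "closedin (top_of_set {0..1}) B"
    using \<open>closed B\<close> by (intro closed_subset) (auto simp: B_def)
  ultimately have "B = {} \<or> B = {0..1}"
    using connected_clopen[of "{0..1::real}"] by auto
  moreover have "0 \<notin> B" using start by (auto simp: B_def)
  ultimately have "1 \<notin> B" by auto
  then show ?thesis using assms(4) by (auto simp: B_def H_def)
qed

text \<open>
  A root of \<open>h (v + t a)\<close> in the open upper half plane would survive the perturbation by \<open>\<i> \<epsilon> e\<close> for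
  small \<open>\<epsilon>\<close>; a root in the lower half plane is excluded by complex conjugation.
\<close>

lemma hyperbolic_change_direction:
  assumes "hyperbolic e" "\<And>\<tau>. 0 \<le> \<tau> \<Longrightarrow> 0 < g (a + \<tau> *\<^sub>R e)"
  shows "hyperbolic a"
  unfolding hyperbolic_def
proof (intro conjI allI impI)
  show a: "0 < g a" using assms(2)[of 0] by simp
  have nonpos: "\<not> 0 < Im t" if root: "h ((v, 0) + cscale t (a, 0)) = 0" for v t
  proof
    assume t: "0 < Im t"
    define f where "f = (\<lambda>\<epsilon>. g a * Im t ^ N - norm (h ((v, \<epsilon> *\<^sub>R e) + cscale t (a, 0))))"
    have "continuous_on UNIV f" unfolding f_def by (intro continuous_on_h continuous_intros)
    then have "open (f -` {0<..})" by (intro open_vimage) auto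
    moreover have "0 < f 0" using t a root by (simp add: f_def)
    ultimately obtain \<delta> where \<delta>: "0 < \<delta>" "\<And>s. dist s 0 < \<delta> \<Longrightarrow> 0 < f s"
      unfolding open_dist by (metis greaterThan_iff vimageE vimageI)
    define \<epsilon> where "\<epsilon> = \<delta> / 2"
    have \<epsilon>: "0 < \<epsilon>" "0 < f \<epsilon>" using \<delta> by (auto simp: \<epsilon>_def)
    obtain p where p: "degree p = N" "lead_coeff p = of_real (g a)"
      "\<And>t. h ((v, \<epsilon> *\<^sub>R e) + cscale t (a, 0)) = poly p t"
      using h_line_degree[of a "(v, \<epsilon> *\<^sub>R e)"] a by (metis less_irrefl)
    have "norm (poly p t) < norm (lead_coeff p) * Im t ^ N"
      using \<epsilon> a unfolding p(2) by (simp add: f_def p(3))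
    then obtain r where r: "poly p r = 0" "dist r t < Im t"
      using root_near_small_value[of p N t "Im t"] p degree_pos a t by auto
    then have "\<bar>Im r - Im t\<bar> < Im t"
      using abs_Im_le_cmod[of "r - t"] by (simp add: dist_norm)
    then have "0 \<le> Im r" by linarith
    then show False
      using no_roots_upper_half_plane[OF assms \<epsilon>(1), of r v] r(1) p(3) by auto
  qed
  fix v t assume root: "h ((v, 0) + cscale t (a, 0)) = 0"
  have "h ((v, 0) + cscale (cnj t) (a, 0)) = cnj (h ((v, 0) + cscale t (a, 0)))"
    using h_cnj[of "v + Re t *\<^sub>R a" "Im t *\<^sub>R a"] by (simp add: cscale_def)
  then show "Im t = 0" using nonpos[OF root] nonpos[of v "cnj t"] root by simp
qed

text \<open>
  Read backwards by homogeneity, a factorization of \<open>h (v + t x)\<close> over its real roots \<open>r\<^sub>i\<close> becomes one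
  of \<open>g (x + t v)\<close> with \<open>\<mu>\<^sub>i = - r\<^sub>i\<close>.
\<close>

lemma real_factorization:
  assumes "hyperbolic x"
  shows "\<exists>\<mu>::nat \<Rightarrow> real. \<forall>t. g (x + t *\<^sub>R v) = g x * (\<Prod>i<N. 1 + t * \<mu> i)"
proof -
  have x: "0 < g x" using assms by (simp add: hyperbolic_def)
  obtain p where p: "degree p = N" "lead_coeff p = of_real (g x)"
    "\<And>t. h ((v, 0) + cscale t (x, 0)) = poly p t"
    using h_line_degree[of x] x by (metis less_irrefl)
  then obtain A where A: "size A = N" "p = smult (of_real (g x)) (\<Prod>r\<in>#A. [:-r, 1:])"
    using alg_closed_imp_factorization[of p] degree_pos by force
  obtain rs where rs: "A = mset rs" by (metis ex_mset)
  have "Im r = 0" if "r \<in> set rs" for r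
  proof -
    have "poly p r = 0" using that by (subst A(2)) (auto simp: poly_prod_mset rs)
    then show ?thesis using assms p(3) by (metis hyperbolic_def)
  qed
  then have real: "rs ! i = of_real (Re (rs ! i))" if "i < N" for i
    using that A rs by (simp add: complex_eq_iff)
  have poly_p: "poly p t = of_real (g x) * (\<Prod>i<N. t - rs ! i)" for t
  proof -
    have "poly p t = of_real (g x) * (\<Prod>r\<in>#mset rs. t - r)"
      by (subst A(2)) (simp add: poly_prod_mset rs)
    also have "(\<Prod>r\<in>#mset rs. t - r) = prod_list (map (\<lambda>r. t - r) rs)"
      by (metis mset_map prod_mset_prod_list)
    also have "\<dots> = (\<Prod>i<N. t - rs ! i)"
      using A(1) rs by (simp add: prod.list_conv_set_nth atLeast0LessThan)
    finally show ?thesis .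
  qed
  have "g (x + t *\<^sub>R v) = g x * (\<Prod>i<N. 1 + t * (- Re (rs ! i)))" for t
  proof (cases "t = 0")
    case False
    have "(x + t *\<^sub>R v, 0) = cscale (of_real t) ((v, 0) + cscale (of_real (1 / t)) (x, 0))"
      using False by (simp only: cscale_of_real) (simp add: algebra_simps)
    then have "of_real (g (x + t *\<^sub>R v)) = of_real t ^ N * poly p (of_real (1 / t))"
      by (metis h_homogeneous h_real p(3))
    also have "\<dots> = of_real (g x) * (\<Prod>i<N. of_real t * (of_real (1 / t) - rs ! i))"
      by (simp add: poly_p prod.distrib)
    also have "(\<Prod>i<N. of_real t * (of_real (1 / t) - rs ! i)) = (\<Prod>i<N. of_real (1 + t * (- Re (rs ! i))))"
    proof (rule prod.cong)
      fix i assume "i \<in> {..<N}"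
      then obtain c where c: "rs ! i = of_real c" using real by blast
      show "of_real t * (of_real (1 / t) - rs ! i) = of_real (1 + t * (- Re (rs ! i)))"
        using False by (simp add: c right_diff_distrib)
    qed simp
    also have "of_real (g x) * \<dots> = of_real (g x * (\<Prod>i<N. 1 + t * (- Re (rs ! i))))" by simp
    finally show ?thesis using of_real_eq_iff by blast
  qed simp
  then show ?thesis by (intro exI[of _ "\<lambda>i. - Re (rs ! i)"]) blast
qed

end

section \<open>The cone and its edge\<close>

locale garding_cone = complexified_form g h N
  for g :: "'a::euclidean_space \<Rightarrow> real" and h :: "'a \<times> 'a \<Rightarrow> complex" and N :: nat +
  fixes \<Gamma> :: "'a set" and e :: 'a
  assumes polynomial: "real_polynomial_function g"
    and component: "\<Gamma> \<in> components {x. 0 < g x}"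
    and e_in: "e \<in> \<Gamma>"
    and e_hyperbolic: "hyperbolic e"
begin

abbreviation "F \<equiv> log_gradient g"
abbreviation "E \<equiv> edge \<Gamma>"

text \<open>
  The orthogonal complement of the edge is a choice of representatives for \<open>V / E\<close>. A slice
  of \<open>closure \<Gamma> \<inter> E_perp\<close> by a functional of the open polar is compact, while a slice of
  \<open>closure \<Gamma>\<close> itself contains translates of \<open>E\<close>.
\<close>

definition "E_perp = {w. \<forall>q\<in>E. orthogonal w q}"

lemma g_pos: "x \<in> \<Gamma> \<Longrightarrow> 0 < g x"
  using in_components_subset[OF component] by auto

lemma open_cone: "open \<Gamma>"
  using open_components[OF open_positive component] .

lemma cone_maximal: "\<lbrakk>connected T; T \<subseteq> {x. 0 < g x}; x \<in> \<Gamma>; x \<in> T\<rbrakk> \<Longrightarrow> T \<subseteq> \<Gamma>"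
  using components_maximal[OF component] by blast

lemma hyperbolic_cone: "x \<in> \<Gamma> \<Longrightarrow> hyperbolic x"
  using hyperbolic_change_direction[OF e_hyperbolic]
    component_star_shaped[OF e_hyperbolic component e_in] positive_segment_iff[of x e]
  by blast

lemma in_cone_if_segment: "\<lbrakk>x \<in> \<Gamma>; closed_segment x z \<subseteq> {x. 0 < g x}\<rbrakk> \<Longrightarrow> z \<in> \<Gamma>"
  using cone_maximal[of "closed_segment x z" x] by auto

text \<open>
  Every point of \<open>\<Gamma>\<close> is a hyperbolic direction, so \<open>\<Gamma>\<close> is star-shaped about each of its points.
\<close>

lemma convex_cone: "convex \<Gamma>"
proof -
  have "closed_segment a b \<subseteq> \<Gamma>" if "a \<in> \<Gamma>" "b \<in> \<Gamma>" for a b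
    using component_star_shaped[OF hyperbolic_cone[OF that(2)] component that(2,1)] that
    by (intro cone_maximal[of _ a]) auto
  then show ?thesis by (simp add: convex_contains_segment)
qed

lemma cone_scale: "\<lbrakk>x \<in> \<Gamma>; 0 < c\<rbrakk> \<Longrightarrow> c *\<^sub>R x \<in> \<Gamma>"
proof (rule in_cone_if_segment)
  assume x: "x \<in> \<Gamma>" and c: "0 < c"
  show "closed_segment x (c *\<^sub>R x) \<subseteq> {x. 0 < g x}"
  proof
    fix y assume "y \<in> closed_segment x (c *\<^sub>R x)"
    then obtain u where u: "0 \<le> u" "u \<le> 1" "y = (1 - u) *\<^sub>R x + u *\<^sub>R c *\<^sub>R x"
      by (auto simp: closed_segment_def)
    then have "y = ((1 - u) + u * c) *\<^sub>R x" by (simp add: algebra_simps)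
    moreover have "0 < (1 - u) + u * c"
      using u c by (cases "u = 1") (auto intro: add_pos_nonneg)
    ultimately show "y \<in> {x. 0 < g x}" using g_pos[OF x] by (simp add: homogeneous)
  qed
qed

lemma cone_add: "x + y \<in> \<Gamma>" if "x \<in> \<Gamma>" "y \<in> \<Gamma>"
proof -
  have "(1/2) *\<^sub>R x + (1/2) *\<^sub>R y \<in> \<Gamma>"
    using convexD[OF convex_cone that, of "1/2" "1/2"] by simp
  from cone_scale[OF this, of 2] show ?thesis by (simp add: scaleR_add_right)
qed

lemma cone_add_closure:
  assumes "x \<in> \<Gamma>" "v \<in> closure \<Gamma>"
  shows "x + v \<in> \<Gamma>"
proof -
  obtain \<delta> where \<delta>: "0 < \<delta>" "ball x \<delta> \<subseteq> \<Gamma>" using open_cone \<open>x \<in> \<Gamma>\<close> by (meson openE)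
  obtain v' where v': "v' \<in> \<Gamma>" "dist v' v < \<delta>" using assms(2) \<delta>(1) unfolding closure_approachable by blast
  have "x + (v - v') \<in> \<Gamma>"
    using v' \<delta> by (auto simp: dist_norm norm_minus_commute intro!: subsetD[OF \<delta>(2)])
  from cone_add[OF this v'(1)] show ?thesis by simp
qed

lemma closure_scale: "v \<in> closure \<Gamma> \<Longrightarrow> 0 < c \<Longrightarrow> c *\<^sub>R v \<in> closure \<Gamma>"
proof -
  assume "v \<in> closure \<Gamma>" "0 < c"
  then have "c *\<^sub>R v \<in> closure ((*\<^sub>R) c ` \<Gamma>)"
    by (simp flip: closure_scaleR)
  moreover have "(*\<^sub>R) c ` \<Gamma> \<subseteq> \<Gamma>" using cone_scale \<open>0 < c\<close> by auto
  ultimately show ?thesis using closure_mono by blast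
qed

lemma cone_ray: "\<lbrakk>x \<in> \<Gamma>; v \<in> closure \<Gamma>; 0 \<le> t\<rbrakk> \<Longrightarrow> x + t *\<^sub>R v \<in> \<Gamma>"
  by (cases "t = 0") (auto intro!: cone_add_closure closure_scale)

lemma closure_if_ray: "v \<in> closure \<Gamma>" if "x \<in> \<Gamma>" "\<And>t. 0 \<le> t \<Longrightarrow> x + t *\<^sub>R v \<in> \<Gamma>"
proof -
  define s where "s = (\<lambda>n. inverse (real (Suc n)) *\<^sub>R x + v)"
  have "s n \<in> \<Gamma>" for n
  proof -
    have "s n = inverse (real (Suc n)) *\<^sub>R (x + real (Suc n) *\<^sub>R v)"
      by (simp add: s_def scaleR_add_right del: of_nat_Suc)
    then show ?thesis using cone_scale[OF that(2)[of "real (Suc n)"]] by simp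
  qed
  moreover have "s \<longlonglongrightarrow> 0 *\<^sub>R x + v"
    unfolding s_def by (intro tendsto_intros LIMSEQ_inverse_real_of_nat)
  ultimately show ?thesis by (auto simp: closure_sequential)
qed

text \<open>
  This turns the edge, defined by closures, into the set of directions of lines inside the open cone,
  where factorizations of \<open>g\<close> are available.
\<close>

lemma edge_iff_line:
  assumes "x \<in> \<Gamma>"
  shows "v \<in> E \<longleftrightarrow> (\<forall>t. x + t *\<^sub>R v \<in> \<Gamma>)"
proof
  assume v: "v \<in> E"
  then have "v \<in> closure \<Gamma>" "- v \<in> closure \<Gamma>" by (auto simp: edge_def)
  then show "\<forall>t. x + t *\<^sub>R v \<in> \<Gamma>"
    using cone_ray[OF assms, of v] cone_ray[OF assms, of "- v" "- t" for t]
    by (metis linorder_le_cases minus_minus neg_0_le_iff_le scaleR_minus_left scaleR_minus_right)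
next
  assume line: "\<forall>t. x + t *\<^sub>R v \<in> \<Gamma>"
  have "x + t *\<^sub>R (- v) \<in> \<Gamma>" for t using line[rule_format, of "- t"] by simp
  then have "- v \<in> closure \<Gamma>" "v \<in> closure \<Gamma>"
    using line by (auto intro!: closure_if_ray[OF assms])
  then show "v \<in> E" unfolding edge_def by (metis IntI imageI minus_minus)
qed

lemma subspace_edge: "subspace E"
proof (rule subspaceI)
  show "0 \<in> E" using edge_iff_line[OF e_in] e_in by simp
  show "v + w \<in> E" if v: "v \<in> E" and w: "w \<in> E" for v w
    unfolding edge_iff_line[OF e_in]
  proof
    fix t
    have "e + t *\<^sub>R v \<in> \<Gamma>" using v edge_iff_line[OF e_in] by blast
    from edge_iff_line[OF this, of w] w have "(e + t *\<^sub>R v) + t *\<^sub>R w \<in> \<Gamma>" by blast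
    then show "e + t *\<^sub>R (v + w) \<in> \<Gamma>" by (simp add: algebra_simps)
  qed
  show "c *\<^sub>R v \<in> E" if "v \<in> E" for c v
    using that unfolding edge_iff_line[OF e_in] by simp
qed

lemma cone_add_edge: "x \<in> \<Gamma> \<Longrightarrow> v \<in> E \<Longrightarrow> x + v \<in> \<Gamma>"
  using edge_iff_line[of x v] by (auto dest: spec[of _ 1])

lemma subspace_E_perp: "subspace E_perp"
  unfolding E_perp_def by (intro subspaceI) (simp_all add: orthogonal_def inner_add_left)

lemma E_perp_Int_edge: "w \<in> E_perp \<Longrightarrow> w \<in> E \<Longrightarrow> w = 0"
  by (auto simp: E_perp_def orthogonal_self)

lemma closed_E_perp: "closed E_perp"
  by (simp add: closed_subspace subspace_E_perp)

lemma edge_complement: obtains p q where "p \<in> E_perp" "q \<in> E" "v = p + q"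
proof -
  obtain q p where "q \<in> span E" "\<And>w. w \<in> span E \<Longrightarrow> orthogonal p w" "v = q + p"
    by (rule orthogonal_subspace_decomp_exists[of E v]) blast
  moreover have "span E = E" using subspace_edge by (simp add: span_eq_iff)
  ultimately show thesis
    using that[of p q] by (simp add: E_perp_def add.commute)
qed

section \<open>Concavity of the logarithm\<close>

lemma log_has_derivative:
  assumes "x \<in> \<Gamma>"
  shows "((\<lambda>z. ln (g z)) has_derivative blinfun_apply (F x)) (at x)"
proof -
  obtain D where D: "(g has_derivative D) (at x)"
    using differentiable_at_real_polynomial_function[OF polynomial] unfolding differentiable_def by blast
  have "((\<lambda>z. ln (g z)) has_derivative (\<lambda>v. D v * inverse (g x))) (at x)"
    using has_derivative_ln[OF g_pos[OF assms] D] by (simp add: divide_inverse)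
  then have *: "((\<lambda>z. ln (g z)) has_derivative frechet_derivative (\<lambda>z. ln (g z)) (at x)) (at x)"
    using frechet_derivative_works differentiable_def by blast
  then have "bounded_linear (frechet_derivative (\<lambda>z. ln (g z)) (at x))"
    by (rule has_derivative_bounded_linear)
  then show ?thesis using * by (simp add: log_gradient_def bounded_linear_Blinfun_apply)
qed

text \<open>
  Logarithmic differentiation of the product at \<open>t = 0\<close>.
\<close>

lemma gradient_eq_sum:
  assumes "x \<in> \<Gamma>" "\<And>t. g (x + t *\<^sub>R v) = g x * (\<Prod>i<N. 1 + t * \<mu> i)"
  shows "F x v = (\<Sum>i<N. \<mu> i)"
proof -
  have "((\<lambda>t. x + t *\<^sub>R v) has_derivative (\<lambda>t. t *\<^sub>R v)) (at 0)"
    by (auto intro!: derivative_eq_intros)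
  from has_derivative_compose[OF this, of "\<lambda>z. ln (g z)" "F x"] log_has_derivative[OF assms(1)]
  have "((\<lambda>t. ln (g (x + t *\<^sub>R v))) has_derivative (\<lambda>t. F x (t *\<^sub>R v))) (at 0)"
    by simp
  then have 1: "((\<lambda>t. ln (g (x + t *\<^sub>R v))) has_field_derivative F x v) (at 0)"
    by (simp add: has_field_derivative_def blinfun.scaleR_right mult.commute[of _ "F x v"])
  have "((\<lambda>t. 1 + t * \<mu> i) has_field_derivative \<mu> i) (at 0)" for i
    by (auto intro!: derivative_eq_intros)
  then have "((\<lambda>t. \<Prod>i<N. 1 + t * \<mu> i) has_field_derivative (\<Sum>i<N. \<mu> i)) (at 0)"
    using has_field_derivative_prod'[of "{..<N}" "\<lambda>i t. 1 + t * \<mu> i" 0 \<mu>] by simp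
  then have D: "((\<lambda>t. g x * (\<Prod>i<N. 1 + t * \<mu> i)) has_field_derivative g x * (\<Sum>i<N. \<mu> i)) (at 0)"
    by (rule DERIV_cmult)
  have "((\<lambda>t. ln (g x * (\<Prod>i<N. 1 + t * \<mu> i))) has_field_derivative
      inverse (g x) * (g x * (\<Sum>i<N. \<mu> i))) (at 0)"
    using DERIV_ln[OF g_pos[OF assms(1)]] by (intro DERIV_chain2[where f = ln, OF _ D]) simp
  then have "((\<lambda>t. ln (g (x + t *\<^sub>R v))) has_field_derivative (\<Sum>i<N. \<mu> i)) (at 0)"
    using g_pos[OF assms(1)] by (simp add: assms(2) flip: mult.assoc)
  with 1 show ?thesis by (rule DERIV_unique)
qed

lemma euler: "x \<in> \<Gamma> \<Longrightarrow> F x x = N"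
proof -
  assume "x \<in> \<Gamma>"
  moreover have "g (x + t *\<^sub>R x) = g x * (\<Prod>i<N. 1 + t * 1)" for t
    using homogeneous[of "1 + t" x] by (simp add: scaleR_add_left mult.commute)
  ultimately show ?thesis using gradient_eq_sum[of x x "\<lambda>_. 1"] by simp
qed

lemma edge_if_constant:
  assumes "x \<in> \<Gamma>" "\<And>t. g (x + t *\<^sub>R v) = g x"
  shows "v \<in> E"
  unfolding edge_iff_line[OF assms(1)]
proof
  fix t
  show "x + t *\<^sub>R v \<in> \<Gamma>"
  proof (rule in_cone_if_segment[OF assms(1)])
    \<comment> \<open>a segment with \<open>g > 0\<close> that starts in the component cannot leave it\<close>
    have "closed_segment x (x + t *\<^sub>R v) \<subseteq> range (\<lambda>s. x + s *\<^sub>R v)"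
    proof
      fix y assume "y \<in> closed_segment x (x + t *\<^sub>R v)"
      then obtain u where "y = (1 - u) *\<^sub>R x + u *\<^sub>R (x + t *\<^sub>R v)"
        by (auto simp: closed_segment_def)
      then have "y = x + (u * t) *\<^sub>R v" by (simp add: algebra_simps)
      then show "y \<in> range (\<lambda>s. x + s *\<^sub>R v)" by blast
    qed
    then show "closed_segment x (x + t *\<^sub>R v) \<subseteq> {x. 0 < g x}"
      using assms g_pos by auto
  qed
qed

text \<open>
  With \<open>v = z - x\<close>, the segment from \<open>x\<close> to \<open>z\<close> lies in \<open>\<Gamma>\<close>, so no factor \<open>1 + t \<mu>\<^sub>i\<close> vanishes on it and
  \<open>1 + \<mu>\<^sub>i > 0\<close>. The claim is then \<open>ln (1 + \<mu>\<^sub>i) \<le> \<mu>\<^sub>i\<close> summed over \<open>i\<close>; equality forces \<open>\<mu>\<^sub>i = 0\<close> for all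
  \<open>i\<close>, and \<open>g\<close> is constant along \<open>v\<close>.
\<close>

lemma log_concave:
  assumes "x \<in> \<Gamma>" "z \<in> \<Gamma>"
  shows "ln (g z) \<le> ln (g x) + F x (z - x)"
    and "ln (g z) = ln (g x) + F x (z - x) \<Longrightarrow> z - x \<in> E"
proof -
  obtain \<mu> where \<mu>: "\<And>t. g (x + t *\<^sub>R (z - x)) = g x * (\<Prod>i<N. 1 + t * \<mu> i)"
    using real_factorization[OF hyperbolic_cone[OF assms(1)]] by blast
  have pos: "0 < 1 + \<mu> i" if "i < N" for i
  proof (rule ccontr)
    assume "\<not> ?thesis"
    then have \<mu>i: "\<mu> i \<le> -1" by simp
    \<comment> \<open>a zero of the factor \<open>1 + t \<mu>\<^sub>i\<close> between \<open>x\<close> and \<open>z\<close>\<close>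
    define t where "t = - 1 / \<mu> i"
    have "x + t *\<^sub>R (z - x) = (1 - t) *\<^sub>R x + t *\<^sub>R z" by (simp add: algebra_simps)
    moreover have "0 \<le> t" "t \<le> 1" using \<mu>i by (auto simp: t_def field_simps)
    ultimately have "x + t *\<^sub>R (z - x) \<in> \<Gamma>"
      using convexD[OF convex_cone assms, of "1 - t" t] by simp
    then have "0 < g (x + t *\<^sub>R (z - x))" by (rule g_pos)
    moreover have "1 + t * \<mu> i = 0" using \<mu>i by (simp add: t_def)
    then have "(\<Prod>i<N. 1 + t * \<mu> i) = 0" using that by (intro prod_zero) auto
    ultimately show False by (simp add: \<mu>)
  qed
  have F: "F x (z - x) = (\<Sum>i<N. \<mu> i)" by (rule gradient_eq_sum[OF assms(1) \<mu>])
  have "g z = g x * (\<Prod>i<N. 1 + \<mu> i)" using \<mu>[of 1] by simp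
  moreover have "0 < (\<Prod>i<N. 1 + \<mu> i)" using pos by (intro prod_pos) auto
  ultimately have "ln (g z) = ln (g x) + ln (\<Prod>i<N. 1 + \<mu> i)"
    using g_pos[OF assms(1)] by (simp only: ln_mult_pos)
  also have "ln (\<Prod>i<N. 1 + \<mu> i) = (\<Sum>i<N. ln (1 + \<mu> i))"
    using pos by (intro ln_prod) (auto dest!: pos)
  finally have ln: "ln (g z) = ln (g x) + (\<Sum>i<N. ln (1 + \<mu> i))" .
  have le: "ln (1 + \<mu> i) \<le> \<mu> i" if "i < N" for i
    using pos[OF that] ln_le_minus_one[of "1 + \<mu> i"] by simp
  then show "ln (g z) \<le> ln (g x) + F x (z - x)"
    unfolding ln F by (auto intro!: sum_mono)
  assume "ln (g z) = ln (g x) + F x (z - x)"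
  then have "(\<Sum>i<N. \<mu> i - ln (1 + \<mu> i)) = 0" using ln F by (simp add: sum_subtractf)
  then have "\<mu> i = ln (1 + \<mu> i)" if "i < N" for i
    using le that by (subst (asm) sum_nonneg_eq_0_iff) auto
  then have "\<mu> i = 0" if "i < N" for i
    using pos[OF that] ln_eq_minus_one[of "1 + \<mu> i"] that by force
  then have "g (x + t *\<^sub>R (z - x)) = g x" for t by (simp add: \<mu>)
  then show "z - x \<in> E" using assms(1) by (rule edge_if_constant[rotated])
qed

text \<open>
  The two tangent inequalities at \<open>x\<close> and \<open>z\<close> become equalities. For \<open>F x = F z\<close> this is injectivity of
  the gradient modulo the edge.
\<close>

lemma gradient_strictly_monotone:
  assumes "x \<in> \<Gamma>" "z \<in> \<Gamma>" "F x (z - x) = F z (z - x)"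
  shows "z - x \<in> E"
proof (rule log_concave(2)[OF assms(1,2)])
  have "F z (x - z) = - F z (z - x)" by (simp add: blinfun.diff_right)
  then show "ln (g z) = ln (g x) + F x (z - x)"
    using log_concave(1)[OF assms(1,2)] log_concave(1)[OF assms(2,1)] assms(3) by linarith
qed

text \<open>
  A nonzero \<open>\<mu>\<^sub>i\<close> would give a zero of \<open>g\<close> on a line that is contained in \<open>\<Gamma>\<close>.
\<close>

lemma g_add_edge:
  assumes "x \<in> \<Gamma>" "v \<in> E"
  shows "g (x + v) = g x"
proof -
  obtain \<mu> where \<mu>: "\<And>t. g (x + t *\<^sub>R v) = g x * (\<Prod>i<N. 1 + t * \<mu> i)"
    using real_factorization[OF hyperbolic_cone[OF assms(1)]] by blast
  have "\<mu> i = 0" if "i < N" for i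
  proof (rule ccontr)
    assume "\<mu> i \<noteq> 0"
    then have "1 + (- 1 / \<mu> i) * \<mu> i = 0" by simp
    then have "(\<Prod>j<N. 1 + (- 1 / \<mu> i) * \<mu> j) = 0" using that by (intro prod_zero) blast+
    then have "g (x + (- 1 / \<mu> i) *\<^sub>R v) = 0" by (simp only: \<mu>)
    moreover have "x + (- 1 / \<mu> i) *\<^sub>R v \<in> \<Gamma>" using edge_iff_line[OF assms(1)] assms(2) by blast
    ultimately show False using g_pos by force
  qed
  then show ?thesis using \<mu>[of 1] by simp
qed

lemma gradient_add_edge:
  assumes "x \<in> \<Gamma>" "v \<in> E"
  shows "F (x + v) = F x"
proof -
  have mem: "x + v \<in> \<Gamma>" using assms by (rule cone_add_edge)
  have "((\<lambda>z. z + v) has_derivative (\<lambda>z. z)) (at x)"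
    by (auto intro!: derivative_eq_intros)
  from has_derivative_compose[OF this, of "\<lambda>z. ln (g z)"] log_has_derivative[OF mem]
  have "((\<lambda>z. ln (g (z + v))) has_derivative F (x + v)) (at x)" by simp
  then have "((\<lambda>z. ln (g z)) has_derivative F (x + v)) (at x)"
    by (rule has_derivative_transform_within_open[OF _ open_cone assms(1)]) (simp add: g_add_edge assms)
  from has_derivative_unique[OF this log_has_derivative[OF assms(1)]]
  show ?thesis by (simp add: blinfun_apply_inject)
qed

text \<open>
  The ray from \<open>x\<close> in direction \<open>v\<close> stays in \<open>\<Gamma>\<close>, so no \<open>\<mu>\<^sub>i\<close> is negative, and their sum is zero only if
  each of them is.
\<close>

lemma gradient_pos:
  assumes "x \<in> \<Gamma>" "v \<in> closure \<Gamma>"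
  shows "0 \<le> F x v" and "F x v = 0 \<Longrightarrow> v \<in> E"
proof -
  obtain \<mu> where \<mu>: "\<And>t. g (x + t *\<^sub>R v) = g x * (\<Prod>i<N. 1 + t * \<mu> i)"
    using real_factorization[OF hyperbolic_cone[OF assms(1)]] by blast
  have nonneg: "0 \<le> \<mu> i" if "i < N" for i
  proof (rule ccontr)
    assume "\<not> ?thesis"
    then have neg: "\<mu> i < 0" by simp
    then have "1 + (- 1 / \<mu> i) * \<mu> i = 0" by simp
    then have "(\<Prod>j<N. 1 + (- 1 / \<mu> i) * \<mu> j) = 0" using that by (intro prod_zero) blast+
    then have "g (x + (- 1 / \<mu> i) *\<^sub>R v) = 0" by (simp only: \<mu>)
    moreover have "x + (- 1 / \<mu> i) *\<^sub>R v \<in> \<Gamma>"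
      using neg by (intro cone_ray assms) (simp add: divide_nonneg_neg)
    ultimately show False using g_pos by force
  qed
  have F: "F x v = (\<Sum>i<N. \<mu> i)" by (rule gradient_eq_sum[OF assms(1) \<mu>])
  show "0 \<le> F x v" unfolding F using nonneg by (auto intro!: sum_nonneg)
  assume "F x v = 0"
  then have "\<mu> i = 0" if "i < N" for i
    using F nonneg that sum_nonneg_eq_0_iff[of "{..<N}" \<mu>] by auto
  then have "g (x + t *\<^sub>R v) = g x" for t by (simp add: \<mu>)
  then show "v \<in> E" using assms(1) by (rule edge_if_constant[rotated])
qed

text \<open>
  The gradients themselves are enough test functionals: \<open>v\<close> is killed by \<open>F e\<close> and by \<open>F (e + s v)\<close> for
  a small \<open>s > 0\<close>, and strict monotonicity of \<open>F\<close> applies.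
\<close>

lemma edge_if_annihilated:
  assumes "\<And>\<eta>. \<eta> \<in> polar \<Gamma> \<Longrightarrow> blinfun_apply \<eta> v = 0"
  shows "v \<in> E"
proof -
  have Fpolar: "F x \<in> polar \<Gamma>" if "x \<in> \<Gamma>" for x
    using gradient_pos(1)[OF that] closure_subset by (auto simp: polar_def)
  obtain \<delta> where \<delta>: "0 < \<delta>" "ball e \<delta> \<subseteq> \<Gamma>" using open_cone e_in by (meson openE)
  \<comment> \<open>small enough for \<open>e + s v\<close> to lie in \<open>\<Gamma>\<close>; adding \<open>1\<close> avoids a separate case \<open>v = 0\<close>\<close>
  define s where "s = \<delta> / (norm v + 1) / 2"
  have "0 < norm v + 1" by (simp add: add_nonneg_pos)
  then have "0 < s" using \<delta> by (simp add: s_def)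
  have "s * norm v < \<delta>"
    using \<delta> \<open>0 < norm v + 1\<close> by (simp add: s_def field_simps)
      (smt (verit) mult_nonneg_nonneg norm_ge_zero)
  then have "e + s *\<^sub>R v \<in> \<Gamma>"
    using \<open>0 < s\<close> by (intro subsetD[OF \<delta>(2)]) (simp add: dist_norm)
  then have "(e + s *\<^sub>R v) - e \<in> E"
    using assms Fpolar e_in by (intro gradient_strictly_monotone) (auto simp: blinfun.scaleR_right)
  then have "inverse s *\<^sub>R (s *\<^sub>R v) \<in> E"
    using subspace_scale[OF subspace_edge] by force
  then show ?thesis using \<open>0 < s\<close> by simp
qed

section \<open>The open polar\<close>

lemma span_polar_zero_on_edge:
  assumes "\<eta> \<in> span (polar \<Gamma>)" "q \<in> E"
  shows "blinfun_apply \<eta> q = 0"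
  using assms(1)
proof (induction rule: span_induct_alt)
  case (step c \<theta> \<eta>)
  have closed: "closed {v. 0 \<le> blinfun_apply \<theta> v}"
    by (intro closed_Collect_le continuous_intros)
  have "closure \<Gamma> \<subseteq> {v. 0 \<le> blinfun_apply \<theta> v}"
    using step.hyps by (intro closure_minimal closed) (auto simp: polar_def)
  moreover have "q \<in> closure \<Gamma>" "- q \<in> closure \<Gamma>" using assms(2) by (auto simp: edge_def)
  ultimately have "0 \<le> blinfun_apply \<theta> q" "0 \<le> blinfun_apply \<theta> (- q)" by auto
  then have "blinfun_apply \<theta> q = 0" by (simp add: blinfun.minus_right)
  then show ?case using step.IH by (simp add: blinfun.add_left blinfun.scaleR_left)
qed simp

lemma gradient_in_polar: "x \<in> \<Gamma> \<Longrightarrow> F x \<in> polar \<Gamma>"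
  using gradient_pos(1) closure_subset by (auto simp: polar_def)

text \<open>
  The unit vectors in \<open>closure \<Gamma> \<inter> E_perp\<close> form a compact set that does not meet \<open>E\<close>.
\<close>

lemma coercive_on_E_perp:
  assumes "\<And>v. v \<in> closure \<Gamma> \<Longrightarrow> v \<notin> E \<Longrightarrow> 0 < blinfun_apply \<eta> v"
  obtains c where "0 < c" "\<And>v. v \<in> closure \<Gamma> \<Longrightarrow> v \<in> E_perp \<Longrightarrow> c * norm v \<le> blinfun_apply \<eta> v"
proof -
  define K where "K = sphere 0 1 \<inter> (closure \<Gamma> \<inter> E_perp)"
  have "compact K" unfolding K_def by (intro compact_Int_closed closed_Int closed_E_perp) auto
  have pos: "0 < blinfun_apply \<eta> v" if "v \<in> K" for v
    using that E_perp_Int_edge[of v] by (intro assms) (auto simp: K_def)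
  obtain c where c: "0 < c" "\<And>v. v \<in> K \<Longrightarrow> c \<le> blinfun_apply \<eta> v"
  proof (cases "K = {}")
    case True
    then show ?thesis using that[of 1] by auto
  next
    case False
    obtain v where "v \<in> K" "\<And>w. w \<in> K \<Longrightarrow> blinfun_apply \<eta> v \<le> blinfun_apply \<eta> w"
      using continuous_attains_inf[OF \<open>compact K\<close> False
         linear_continuous_on[OF blinfun.bounded_linear_right], of \<eta>]
      by blast
    then show ?thesis using that pos by blast
  qed
  have "c * norm v \<le> blinfun_apply \<eta> v" if v: "v \<in> closure \<Gamma>" "v \<in> E_perp" for v
  proof (cases "v = 0")
    case False
    then have "inverse (norm v) *\<^sub>R v \<in> K"
      using v by (auto simp: K_def intro!: closure_scale subspace_scale[OF subspace_E_perp])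
    from c(2)[OF this] show ?thesis
      using False by (simp add: blinfun.scaleR_right field_simps)
  qed simp
  with c(1) that show thesis by blast
qed

text \<open>
  A functional in the span of the polar vanishes on \<open>E\<close>, so it need only be tested on \<open>E_perp\<close>. There
  \<open>F x\<close> is coercive, which absorbs a perturbation of norm less than the coercivity constant.
\<close>

lemma gradient_in_open_polar:
  assumes "x \<in> \<Gamma>"
  shows "F x \<in> open_polar \<Gamma>"
proof -
  obtain c where c: "0 < c" "\<And>v. v \<in> closure \<Gamma> \<Longrightarrow> v \<in> E_perp \<Longrightarrow> c * norm v \<le> F x v"
    using coercive_on_E_perp[of "F x"] gradient_pos[OF assms] by (metis order_le_less)
  let ?T = "ball (F x) c \<inter> span (polar \<Gamma>)"
  have "?T \<subseteq> polar \<Gamma>"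
  proof
    fix \<eta> assume \<eta>: "\<eta> \<in> ?T"
    have "0 \<le> blinfun_apply \<eta> z" if "z \<in> \<Gamma>" for z
    proof -
      obtain p q where pq: "p \<in> E_perp" "q \<in> E" "z = p + q" by (rule edge_complement)
      have "z + (- q) \<in> \<Gamma>"
        using that subspace_neg[OF subspace_edge pq(2)] by (rule cone_add_edge)
      then have "p \<in> closure \<Gamma>" using pq closure_subset by auto
      then have "c * norm p \<le> F x p" using c pq by blast
      moreover have "\<bar>blinfun_apply (F x - \<eta>) p\<bar> \<le> c * norm p"
      proof -
        have "norm (F x - \<eta>) * norm p \<le> c * norm p"
          using \<eta> by (intro mult_right_mono) (auto simp: dist_norm)
        then show ?thesis using norm_blinfun[of "F x - \<eta>" p] by simp
      qed
      moreover have "blinfun_apply \<eta> z = blinfun_apply \<eta> p"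
        using span_polar_zero_on_edge[of \<eta> q] \<eta> pq by (simp add: blinfun.add_right)
      ultimately show ?thesis by (simp add: blinfun.diff_left)
    qed
    then show "\<eta> \<in> polar \<Gamma>" by (simp add: polar_def)
  qed
  moreover have "openin (top_of_set (span (polar \<Gamma>))) ?T"
    by (simp add: openin_open_Int inf_commute)
  moreover have "F x \<in> ?T" using c(1) gradient_in_polar[OF assms] by (simp add: span_base)
  ultimately show ?thesis unfolding open_polar_def interior_of_def by blast
qed

lemma open_polar_ball:
  assumes "y \<in> open_polar \<Gamma>"
  obtains r where "0 < r" "ball y r \<inter> span (polar \<Gamma>) \<subseteq> open_polar \<Gamma>"
proof -
  have "openin (top_of_set (span (polar \<Gamma>))) (open_polar \<Gamma>)"
    unfolding open_polar_def by (rule openin_interior_of)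
  with assms that show thesis unfolding openin_contains_ball by blast
qed

lemma open_polar_subset: "open_polar \<Gamma> \<subseteq> polar \<Gamma>"
  unfolding open_polar_def by (rule interior_of_subset)

lemma open_polar_shift:
  assumes "y \<in> open_polar \<Gamma>" "\<eta> \<in> span (polar \<Gamma>)"
  obtains \<tau> where "0 < \<tau>" "\<And>t. \<bar>t\<bar> \<le> \<tau> \<Longrightarrow> y + t *\<^sub>R \<eta> \<in> open_polar \<Gamma>"
proof -
  obtain r where r: "0 < r" "ball y r \<inter> span (polar \<Gamma>) \<subseteq> open_polar \<Gamma>"
    using open_polar_ball[OF assms(1)] .
  define \<tau> where "\<tau> = r / (2 * (norm \<eta> + 1))"
  have n: "0 < norm \<eta> + 1" by (simp add: add_nonneg_pos)
  have "0 < \<tau>" using r n by (simp add: \<tau>_def)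
  moreover have "y + t *\<^sub>R \<eta> \<in> open_polar \<Gamma>" if "\<bar>t\<bar> \<le> \<tau>" for t
  proof -
    have "\<bar>t\<bar> * norm \<eta> \<le> \<tau> * (norm \<eta> + 1)"
      using that \<open>0 < \<tau>\<close> by (intro mult_mono) auto
    also have "\<tau> * (norm \<eta> + 1) = r / 2" using n by (simp add: \<tau>_def divide_simps)
    also have "r / 2 < r" using r by simp
    finally have "y + t *\<^sub>R \<eta> \<in> ball y r" by (simp add: dist_norm)
    moreover have "y \<in> span (polar \<Gamma>)"
      using assms(1) open_polar_subset by (auto intro: span_base)
    then have "y + t *\<^sub>R \<eta> \<in> span (polar \<Gamma>)"
      by (intro span_add span_scale assms(2))
    ultimately show ?thesis using r(2) by blast
  qed
  ultimately show thesis by (rule that)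
qed

text \<open>
  One may subtract from \<open>y\<close> a small multiple of \<open>F e\<close>, which is positive at \<open>v\<close>, without leaving the polar.
\<close>

lemma open_polar_pos:
  assumes "y \<in> open_polar \<Gamma>" "v \<in> closure \<Gamma>" "v \<notin> E"
  shows "0 < blinfun_apply y v"
proof -
  have pos: "0 < F e v"
    using gradient_pos[OF e_in assms(2)] assms(3) by (metis order_le_less)
  obtain \<tau> where \<tau>: "0 < \<tau>" "\<And>t. \<bar>t\<bar> \<le> \<tau> \<Longrightarrow> y + t *\<^sub>R F e \<in> open_polar \<Gamma>"
    using open_polar_shift[OF assms(1) span_base[OF gradient_in_polar[OF e_in]]] by blast
  have "y + (- \<tau>) *\<^sub>R F e \<in> open_polar \<Gamma>" using \<tau>(1) by (intro \<tau>(2)) simp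
  then have "y + (- \<tau>) *\<^sub>R F e \<in> polar \<Gamma>" using open_polar_subset by (rule subsetD[rotated])
  then have "\<Gamma> \<subseteq> {v. 0 \<le> blinfun_apply (y + (- \<tau>) *\<^sub>R F e) v}" by (auto simp: polar_def)
  then have "closure \<Gamma> \<subseteq> {v. 0 \<le> blinfun_apply (y + (- \<tau>) *\<^sub>R F e) v}"
    by (intro closure_minimal closed_Collect_le continuous_intros)
  then have "0 \<le> blinfun_apply (y + (- \<tau>) *\<^sub>R F e) v" using assms(2) by blast
  then have "\<tau> * F e v \<le> blinfun_apply y v"
    by (simp add: blinfun.add_left blinfun.scaleR_left blinfun.diff_left blinfun.minus_left)
  moreover have "0 < \<tau> * F e v" using pos \<tau>(1) by simp
  ultimately show ?thesis by linarith
qed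

lemma g_zero: "g 0 = 0"
  using homogeneous[of 0 0] degree_pos by (simp add: power_0_left)

lemma cone_Int_edge: "x \<in> \<Gamma> \<Longrightarrow> x \<notin> E"
proof
  assume "x \<in> \<Gamma>" "x \<in> E"
  then have "x + (- x) \<in> \<Gamma>" by (intro cone_add_edge subspace_neg[OF subspace_edge])
  then show False using g_pos[of 0] g_zero by simp
qed

lemma closure_positive_in_cone:
  assumes "m \<in> closure \<Gamma>" "0 < g m"
  shows "m \<in> \<Gamma>"
proof -
  obtain \<delta> where \<delta>: "0 < \<delta>" "ball m \<delta> \<subseteq> {x. 0 < g x}"
    using open_positive assms(2) by (metis mem_Collect_eq openE)
  obtain x where "x \<in> \<Gamma>" "dist x m < \<delta>"
    using assms(1) \<delta>(1) unfolding closure_approachable by blast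
  then have "ball m \<delta> \<subseteq> \<Gamma>"
    using \<delta> by (intro cone_maximal[of _ x]) (auto simp: dist_commute)
  then show ?thesis using \<delta>(1) by auto
qed

section \<open>Surjectivity and continuity of the inverse\<close>

text \<open>
  The slice \<open>K\<close> of \<open>closure \<Gamma> \<inter> E_perp\<close> at height \<open>y = N\<close> is compact, because \<open>y\<close> is coercive. Let \<open>m\<close>
  maximize \<open>g\<close> on it. Rescaling to the slice and moving along \<open>E\<close> turns this into the statement that
  \<open>N ln y - ln g\<close>, which is constant on rays, is minimal at \<open>m\<close> over the open set \<open>\<Gamma>\<close>. Its derivative
  there is \<open>y - F m\<close>, because the height \<open>N\<close> was chosen to cancel the factor \<open>N\<close>.
\<close>

lemma gradient_surjective:
  assumes y: "y \<in> open_polar \<Gamma>"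
  obtains m where "m \<in> \<Gamma>" "F m = y"
proof -
  have N: "0 < real N" using degree_pos by simp
  obtain c where c: "0 < c" "\<And>v. v \<in> closure \<Gamma> \<Longrightarrow> v \<in> E_perp \<Longrightarrow> c * norm v \<le> blinfun_apply y v"
    using coercive_on_E_perp[of y] open_polar_pos[OF y] by blast
  define K where "K = closure \<Gamma> \<inter> E_perp \<inter> {z. blinfun_apply y z = N}"
  have "closed K"
    unfolding K_def by (intro closed_Int closed_closure closed_E_perp closed_Collect_eq continuous_intros)
  moreover have "norm z \<le> N / c" if "z \<in> K" for z
    using c(2)[of z] that \<open>0 < c\<close> by (simp add: K_def pos_le_divide_eq mult.commute)
  then have "bounded K" by (auto simp: bounded_iff)
  ultimately have "compact K" by (simp add: compact_eq_bounded_closed)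
  \<comment> \<open>moving \<open>z\<close> along \<open>E\<close> into \<open>E_perp\<close> and rescaling to height \<open>N\<close> gives a point of \<open>K\<close>\<close>
  have normalize: "\<exists>p\<in>K. g p = (N / blinfun_apply y z) ^ N * g z \<and> p \<in> \<Gamma>" and y_pos: "0 < blinfun_apply y z"
    if "z \<in> \<Gamma>" for z
  proof -
    show yz: "0 < blinfun_apply y z"
      using that closure_subset by (intro open_polar_pos[OF y] cone_Int_edge) auto
    obtain p q where pq: "p \<in> E_perp" "q \<in> E" "z = p + q" by (rule edge_complement)
    have nq: "- q \<in> E" using subspace_neg[OF subspace_edge pq(2)] .
    have p: "p \<in> \<Gamma>" "g p = g z"
      using cone_add_edge[OF that nq] g_add_edge[OF that nq] pq by auto
    have yp: "blinfun_apply y p = blinfun_apply y z"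
      using span_polar_zero_on_edge[of y q] pq open_polar_subset y
      by (auto simp: blinfun.add_right intro: span_base)
    let ?p = "(N / blinfun_apply y z) *\<^sub>R p"
    have "?p \<in> \<Gamma>" using p yz N by (intro cone_scale) auto
    moreover have "?p \<in> K"
      using calculation closure_subset yp yz subspace_scale[OF subspace_E_perp pq(1)]
      by (auto simp: K_def blinfun.scaleR_right)
    moreover have "g ?p = (N / blinfun_apply y z) ^ N * g z" using p by (simp only: homogeneous)
    ultimately show "\<exists>p\<in>K. g p = (N / blinfun_apply y z) ^ N * g z \<and> p \<in> \<Gamma>" by blast
  qed
  obtain p0 where p0: "p0 \<in> K" "p0 \<in> \<Gamma>" using normalize[OF e_in] by blast
  then have "K \<noteq> {}" by blast
  obtain m where m: "m \<in> K" "\<And>p. p \<in> K \<Longrightarrow> g p \<le> g m"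
    using continuous_attains_sup[OF \<open>compact K\<close> \<open>K \<noteq> {}\<close>, of g] continuous_on_g[of K "\<lambda>x. x"]
    by auto
  have "0 < g m" using m(2)[OF p0(1)] g_pos[OF p0(2)] by linarith
  then have m_in: "m \<in> \<Gamma>" using m(1) by (intro closure_positive_in_cone) (auto simp: K_def)
  have ym: "blinfun_apply y m = N" using m(1) by (simp add: K_def)
  define \<psi> where "\<psi> = (\<lambda>z. N * ln (blinfun_apply y z) - ln (g z))"
  have "\<psi> m \<le> \<psi> z" if z: "z \<in> \<Gamma>" for z
  proof -
    obtain p where "p \<in> K" "g p = (N / blinfun_apply y z) ^ N * g z" using normalize[OF z] by blast
    then have "(N / blinfun_apply y z) ^ N * g z \<le> g m" using m(2) by metis
    moreover have pos: "0 < N / blinfun_apply y z" using y_pos[OF z] N by simp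
    ultimately have "ln ((N / blinfun_apply y z) ^ N * g z) \<le> ln (g m)"
      using g_pos[OF z] by (intro ln_mono) (auto intro!: mult_pos_pos)
    also have "ln ((N / blinfun_apply y z) ^ N * g z) = N * (ln N - ln (blinfun_apply y z)) + ln (g z)"
      using pos g_pos[OF z] y_pos[OF z] N by (simp add: ln_mult_pos ln_realpow ln_divide_pos)
    finally show ?thesis by (simp add: \<psi>_def ym algebra_simps)
  qed
  moreover have dy: "(blinfun_apply y has_derivative blinfun_apply y) (at m)"
    by (rule bounded_linear_imp_has_derivative[OF blinfun.bounded_linear_right])
  have "(\<psi> has_derivative (\<lambda>v. real N * (blinfun_apply y v * inverse (blinfun_apply y m)) - F m v)) (at m)"
    unfolding \<psi>_def
    using has_derivative_ln[OF _ dy] ym N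
    by (intro has_derivative_diff has_derivative_mult_right log_has_derivative[OF m_in])
      (simp add: divide_inverse)
  ultimately have "(\<lambda>v. real N * (blinfun_apply y v * inverse (blinfun_apply y m)) - F m v) = (\<lambda>v. 0)"
    by (intro differential_zero_maxmin[OF m_in open_cone]) auto
  then have "real N * (blinfun_apply y v * inverse (blinfun_apply y m)) - F m v = 0" for v by meson
  then have "F m v = blinfun_apply y v" for v using N by (simp add: ym field_simps)
  then have "F m = y" by (rule blinfun_eqI)
  with m_in that show thesis by blast
qed

text \<open>
  Let \<open>gap v\<close> be the amount by which the tangent at \<open>x\<close> exceeds \<open>ln g\<close> at \<open>x + v\<close>. It is convex, vanishes
  at \<open>0\<close>, and on the small sphere \<open>K\<close> of radius \<open>r\<close> in \<open>E_perp\<close> it has a positive lower bound \<open>\<kappa>\<close>. So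
  it is at least \<open>\<kappa> |w| / r\<close> for \<open>|w| \<ge> r\<close>, while it is at most \<open>(F x - F (x + w)) w\<close>. Gradients at
  points that far away therefore differ from \<open>F x\<close> by at least \<open>\<kappa> / r\<close>.
\<close>

lemma gradient_inverse_continuous:
  assumes x: "x \<in> \<Gamma>" and "0 < \<epsilon>"
  obtains \<delta> where "0 < \<delta>" "\<And>z. z \<in> \<Gamma> \<Longrightarrow> z - x \<in> E_perp \<Longrightarrow> dist (F z) (F x) < \<delta> \<Longrightarrow> dist z x < \<epsilon>"
proof -
  obtain r0 where r0: "0 < r0" "ball x r0 \<subseteq> \<Gamma>" using open_cone x by (meson openE)
  define r where "r = min \<epsilon> (r0 / 2)"
  have r: "0 < r" "r \<le> \<epsilon>" "r < r0" using r0 \<open>0 < \<epsilon>\<close> by (auto simp: r_def)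
  define gap where "gap = (\<lambda>v. ln (g x) + F x v - ln (g (x + v)))"
  define K where "K = sphere 0 r \<inter> E_perp"
  have "compact K" unfolding K_def by (intro compact_Int_closed closed_E_perp) auto
  have K_in: "x + v \<in> \<Gamma>" if "v \<in> K" for v
    using that r by (intro subsetD[OF r0(2)]) (auto simp: K_def dist_norm)
  have gap_pos: "0 < gap v" if "v \<in> K" for v
  proof -
    have "v \<notin> E" using that r E_perp_Int_edge[of v] by (auto simp: K_def)
    then have "ln (g (x + v)) \<noteq> ln (g x) + F x v"
      using log_concave(2)[OF x K_in[OF that]] by auto
    then show ?thesis using log_concave(1)[OF x K_in[OF that]] by (simp add: gap_def)
  qed
  have "continuous_on K gap"
    unfolding gap_def
    using K_in g_pos by (intro continuous_intros continuous_on_g) (metis less_irrefl)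
  obtain \<kappa> where \<kappa>: "0 < \<kappa>" "\<And>v. v \<in> K \<Longrightarrow> \<kappa> \<le> gap v"
  proof (cases "K = {}")
    case True
    then show ?thesis using that[of 1] by auto
  next
    case False
    obtain v where "v \<in> K" "\<And>w. w \<in> K \<Longrightarrow> gap v \<le> gap w"
      using continuous_attains_inf[OF \<open>compact K\<close> False \<open>continuous_on K gap\<close>] by blast
    then show ?thesis using that gap_pos by blast
  qed
  have "dist z x < \<epsilon>" if z: "z \<in> \<Gamma>" "z - x \<in> E_perp" "dist (F z) (F x) < \<kappa> / r" for z
  proof (rule ccontr)
    assume "\<not> dist z x < \<epsilon>"
    define w where "w = z - x"
    \<comment> \<open>the point \<open>x + v\<close> is where the segment from \<open>x\<close> to \<open>z = x + s v\<close> crosses the sphere of radius \<open>r\<close> about \<open>x\<close>\<close>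
    define s where "s = norm w / r"
    define v where "v = inverse s *\<^sub>R w"
    have "r \<le> norm w" using \<open>\<not> dist z x < \<epsilon>\<close> r by (simp add: w_def dist_norm)
    then have s: "1 \<le> s" using r by (simp add: s_def)
    have "v \<in> K"
      using s r z(2) by (auto simp: K_def v_def s_def w_def norm_inverse intro: subspace_scale[OF subspace_E_perp])
    have zv: "z = (x + v) + (s - 1) *\<^sub>R v" and zx: "z = x + s *\<^sub>R v"
      using s by (simp_all add: v_def w_def algebra_simps)
    have "ln (g x) \<le> ln (g (x + v)) - F (x + v) v"
      using log_concave(1)[OF K_in[OF \<open>v \<in> K\<close>] x] by (simp add: blinfun.minus_right)
    then have "(s - 1) * ln (g x) \<le> (s - 1) * (ln (g (x + v)) - F (x + v) v)"
      using s by (intro mult_left_mono) auto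
    moreover have "ln (g z) \<le> ln (g (x + v)) + (s - 1) * F (x + v) v"
      using log_concave(1)[OF K_in[OF \<open>v \<in> K\<close>] z(1)] zv by (simp add: blinfun.scaleR_right)
    moreover have "s * \<kappa> \<le> s * gap v" using \<kappa>(2)[OF \<open>v \<in> K\<close>] s by (intro mult_left_mono) auto
    \<comment> \<open>the two inequalities at \<open>x + v\<close> express concavity of \<open>ln g\<close> at a point between \<open>x\<close> and \<open>z\<close>\<close>
    ultimately have "s * \<kappa> \<le> ln (g x) + s * F x v - ln (g z)"
      by (simp add: gap_def algebra_simps)
    also have "\<dots> \<le> F x (s *\<^sub>R v) - F z (s *\<^sub>R v)"
      using log_concave(1)[OF z(1) x] zx by (simp add: blinfun.scaleR_right blinfun.minus_right)
    also have "\<dots> = blinfun_apply (F x - F z) w"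
      using s by (simp add: v_def blinfun.diff_left)
    also have "\<dots> \<le> norm (F x - F z) * norm w"
      using norm_blinfun[of "F x - F z" w] by simp
    also have "\<dots> < \<kappa> / r * norm w"
      using z(3) r \<open>r \<le> norm w\<close> by (intro mult_strict_right_mono) (auto simp: dist_norm norm_minus_commute)
    also have "\<dots> = s * \<kappa>" by (simp add: s_def)
    finally show False by simp
  qed
  then show thesis using that[of "\<kappa> / r"] \<kappa>(1) r(1) by simp
qed

section \<open>The dual function and its gradient\<close>

lemma gradient_fiber:
  assumes "x \<in> \<Gamma>"
  shows "{z \<in> \<Gamma>. F z = F x} = x +o E"
proof (intro set_eqI iffI)
  fix z assume "z \<in> {z \<in> \<Gamma>. F z = F x}"
  then have "z - x \<in> E" using assms by (intro gradient_strictly_monotone) auto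
  then show "z \<in> x +o E" unfolding elt_set_plus_def by force
next
  fix z assume "z \<in> x +o E"
  then show "z \<in> {z \<in> \<Gamma>. F z = F x}"
    using assms by (auto simp: elt_set_plus_def cone_add_edge gradient_add_edge)
qed

lemma gradient_map_coset:
  assumes "x \<in> \<Gamma>"
  shows "gradient_map g (x +o E) = F x"
proof -
  have "x +o E \<noteq> {}" using subspace_0[OF subspace_edge] by (auto simp: elt_set_plus_def)
  then have "F ` (x +o E) = {F x}" using gradient_fiber[OF assms, symmetric] by auto
  then show ?thesis by (simp add: gradient_map_def)
qed

lemma dual_garding_gradient:
  assumes "x \<in> \<Gamma>"
  shows "dual_garding g \<Gamma> (F x) = 1 / g x"
proof -
  have "(\<lambda>x. 1 / g x) ` (x +o E) = {1 / g x}"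
    using subspace_0[OF subspace_edge] assms by (force simp: elt_set_plus_def g_add_edge)
  then show ?thesis by (simp add: dual_garding_def gradient_fiber[OF assms])
qed

text \<open>
  For \<open>\<eta> = F z\<close> the difference \<open>ln (dual_garding g \<Gamma> \<eta>) - ln (dual_garding g \<Gamma> (F x))\<close> is
  \<open>ln (g x) - ln (g z)\<close>. The tangent inequalities at \<open>x\<close> and at \<open>z\<close>, with Euler's identity
  \<open>F x x = \<eta> z = N\<close>, place it between \<open>(\<eta> - F x) z\<close> and \<open>(\<eta> - F x) x\<close>. The representative \<open>z\<close> is
  chosen with \<open>z - x \<in> E_perp\<close>, so that it is close to \<open>x\<close>.
\<close>

lemma dual_garding_has_derivative:
  assumes x: "x \<in> \<Gamma>"
  shows "((\<lambda>\<eta>. ln (dual_garding g \<Gamma> \<eta>)) has_derivative (\<lambda>\<eta>. blinfun_apply \<eta> x))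
           (at (F x) within open_polar \<Gamma>)"
  unfolding has_derivative_within_alt
proof (intro conjI allI impI)
  show "bounded_linear (\<lambda>\<eta>. blinfun_apply \<eta> x)" by (rule blinfun.bounded_linear_left)
  fix \<epsilon> :: real assume "0 < \<epsilon>"
  then obtain \<delta> where \<delta>: "0 < \<delta>"
    "\<And>z. z \<in> \<Gamma> \<Longrightarrow> z - x \<in> E_perp \<Longrightarrow> dist (F z) (F x) < \<delta> \<Longrightarrow> dist z x < \<epsilon>"
    using gradient_inverse_continuous[OF x] by blast
  have "norm (ln (dual_garding g \<Gamma> \<eta>) - ln (dual_garding g \<Gamma> (F x)) - blinfun_apply (\<eta> - F x) x)
      \<le> \<epsilon> * norm (\<eta> - F x)" if \<eta>: "\<eta> \<in> open_polar \<Gamma>" "norm (\<eta> - F x) < \<delta>" for \<eta>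
  proof -
    obtain m where m: "m \<in> \<Gamma>" "F m = \<eta>" using gradient_surjective[OF \<eta>(1)] .
    obtain p q where pq: "p \<in> E_perp" "q \<in> E" "m - x = p + q" by (rule edge_complement)
    define z where "z = x + p"
    have "z = m + (- q)" using pq(3) by (simp add: z_def algebra_simps)
    then have z: "z \<in> \<Gamma>" "F z = \<eta>"
      using m subspace_neg[OF subspace_edge pq(2)] by (simp_all only: cone_add_edge gradient_add_edge)
    have "dist z x < \<epsilon>" using pq(1) \<eta>(2) z by (intro \<delta>(2)) (auto simp: z_def dist_norm)
    define \<Delta> where "\<Delta> = ln (dual_garding g \<Gamma> \<eta>) - ln (dual_garding g \<Gamma> (F x)) - blinfun_apply (\<eta> - F x) x"
    have "\<Delta> = ln (g x) - ln (g z) - blinfun_apply (\<eta> - F x) x"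
      using dual_garding_gradient[OF z(1)] dual_garding_gradient[OF x] z(2) g_pos[OF x] g_pos[OF z(1)]
      by (simp add: \<Delta>_def ln_divide_pos)
    moreover have "ln (g z) \<le> ln (g x) + (F x z - N)"
      using log_concave(1)[OF x z(1)] euler[OF x] by (simp add: blinfun.diff_right)
    moreover have "ln (g x) \<le> ln (g z) + (blinfun_apply \<eta> x - N)"
      using log_concave(1)[OF z(1) x] euler[OF z(1)] z(2) by (simp add: blinfun.diff_right)
    moreover have "blinfun_apply \<eta> z = N" "F x x = N" using euler x z by auto
    ultimately have "\<Delta> \<le> 0" "blinfun_apply (\<eta> - F x) (z - x) \<le> \<Delta>"
      by (simp_all add: blinfun.diff_left blinfun.diff_right)
    then have "\<bar>\<Delta>\<bar> \<le> \<bar>blinfun_apply (\<eta> - F x) (z - x)\<bar>" by linarith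
    also have "\<dots> \<le> norm (\<eta> - F x) * norm (z - x)"
      using norm_blinfun[of "\<eta> - F x" "z - x"] by simp
    also have "\<dots> \<le> norm (\<eta> - F x) * \<epsilon>"
      using \<open>dist z x < \<epsilon>\<close> by (intro mult_left_mono) (auto simp: dist_norm)
    finally show ?thesis by (simp add: \<Delta>_def mult.commute)
  qed
  then show "\<exists>\<delta>>0. \<forall>\<eta>\<in>open_polar \<Gamma>. norm (\<eta> - F x) < \<delta> \<longrightarrow>
      norm (ln (dual_garding g \<Gamma> \<eta>) - ln (dual_garding g \<Gamma> (F x)) - blinfun_apply (\<eta> - F x) x)
      \<le> \<epsilon> * norm (\<eta> - F x)" using \<delta>(1) by blast
qed

text \<open>
  The open polar contains a short segment through \<open>y\<close> in the direction of each \<open>\<eta>\<close> in the polar, so the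
  value \<open>\<eta> x\<close> is determined by \<open>f\<close>; the functionals of the polar separate points modulo \<open>E\<close>.
\<close>

lemma derivative_representative_unique:
  assumes y: "y \<in> open_polar \<Gamma>"
    and "(f has_derivative (\<lambda>\<eta>. blinfun_apply \<eta> x)) (at y within open_polar \<Gamma>)"
    and "(f has_derivative (\<lambda>\<eta>. blinfun_apply \<eta> x')) (at y within open_polar \<Gamma>)"
  shows "x' - x \<in> E"
proof (rule edge_if_annihilated)
  fix \<eta> assume "\<eta> \<in> polar \<Gamma>"
  then obtain \<tau> where \<tau>: "0 < \<tau>" "\<And>t. \<bar>t\<bar> \<le> \<tau> \<Longrightarrow> y + t *\<^sub>R \<eta> \<in> open_polar \<Gamma>"
    using open_polar_shift[OF y span_base] by blast
  have along: "((\<lambda>t. f (y + t *\<^sub>R \<eta>)) has_derivative (\<lambda>t. t * blinfun_apply \<eta> u)) (at 0)"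
    if "(f has_derivative (\<lambda>\<eta>. blinfun_apply \<eta> u)) (at y within open_polar \<Gamma>)" for u
  proof -
    have "((\<lambda>t. f (y + t *\<^sub>R \<eta>)) has_derivative (\<lambda>t. blinfun_apply (t *\<^sub>R \<eta>) u)) (at 0 within {-\<tau><..<\<tau>})"
    proof (rule has_derivative_in_compose[where f = "\<lambda>t. y + t *\<^sub>R \<eta>" and g = f
          and g' = "\<lambda>\<eta>. blinfun_apply \<eta> u"])
      show "((\<lambda>t. y + t *\<^sub>R \<eta>) has_derivative (\<lambda>t. t *\<^sub>R \<eta>)) (at 0 within {-\<tau><..<\<tau>})"
        by (auto intro!: derivative_eq_intros)
      have "(\<lambda>t. y + t *\<^sub>R \<eta>) ` {-\<tau><..<\<tau>} \<subseteq> open_polar \<Gamma>" using \<tau>(2) by auto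
      with that show "(f has_derivative (\<lambda>\<eta>. blinfun_apply \<eta> u))
          (at (y + 0 *\<^sub>R \<eta>) within (\<lambda>t. y + t *\<^sub>R \<eta>) ` {-\<tau><..<\<tau>})"
        by (simp add: has_derivative_subset)
    qed
    moreover have "at 0 within {-\<tau><..<\<tau>} = at 0"
      using \<tau>(1) by (intro at_within_open) auto
    ultimately show ?thesis by (simp add: blinfun.scaleR_left)
  qed
  have "(\<lambda>t. t * blinfun_apply \<eta> x) = (\<lambda>t. t * blinfun_apply \<eta> x')"
    by (rule has_derivative_unique[OF along[OF assms(2)] along[OF assms(3)]])
  from fun_cong[OF this, of 1] show "blinfun_apply \<eta> (x' - x) = 0" by (simp add: blinfun.diff_right)
qed

lemma dual_gradient_map_gradient:
  assumes "x \<in> \<Gamma>"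
  shows "dual_gradient_map g \<Gamma> (F x) = x +o E"
proof (intro set_eqI iffI)
  fix x' assume "x' \<in> dual_gradient_map g \<Gamma> (F x)"
  then have "x' - x \<in> E"
    using derivative_representative_unique[OF gradient_in_open_polar[OF assms] dual_garding_has_derivative[OF assms]]
    by (simp add: dual_gradient_map_def)
  then show "x' \<in> x +o E" unfolding elt_set_plus_def by force
next
  fix x' assume "x' \<in> x +o E"
  then have "x' \<in> \<Gamma>" "F x' = F x" using gradient_fiber[OF assms] by auto
  then show "x' \<in> dual_gradient_map g \<Gamma> (F x)"
    using dual_garding_has_derivative[of x'] by (simp add: dual_gradient_map_def)
qed

end

theorem theorem10p5:
  fixes g :: "'a::euclidean_space \<Rightarrow> real" and \<Gamma> :: "'a set" and N :: nat
  assumes "1 \<le> N"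
    and "garding_polynomial N g \<Gamma>"
  shows "gradient_map g \<in> cone_quotient \<Gamma> \<rightarrow> open_polar \<Gamma>
    \<and> dual_gradient_map g \<Gamma> \<in> open_polar \<Gamma> \<rightarrow> cone_quotient \<Gamma>
    \<and> (\<forall>X \<in> cone_quotient \<Gamma>. dual_gradient_map g \<Gamma> (gradient_map g X) = X)
    \<and> (\<forall>y \<in> open_polar \<Gamma>. gradient_map g (dual_gradient_map g \<Gamma> y) = y)"
proof -
  have g: "real_polynomial_function g" "\<And>c x. g (c *\<^sub>R x) = c ^ N * g x" "\<Gamma> \<in> components {x. 0 < g x}"
    using assms(2) by (auto simp: garding_polynomial_def)
  obtain e where e: "e \<in> \<Gamma>"
    "\<And>v. \<exists>p :: real poly. (\<forall>t. poly p t = g (t *\<^sub>R e + v)) \<and> size (proots p) = N"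
    using assms(2) by (auto simp: garding_polynomial_def)
  obtain h where h: "complex_extension g h" using complex_extension_exists[OF g(1)] by blast
  interpret complexified_form g h N
    by standard (use h g(2) assms(1) in auto)
  have "0 < g e" using e(1) in_components_subset[OF g(3)] by auto
  then have "hyperbolic e" using e(2) by (rule hyperbolicI_real_roots)
  then interpret garding_cone g h N \<Gamma> e
    by unfold_locales (use g e in auto)
  have "gradient_map g X \<in> open_polar \<Gamma> \<and> dual_gradient_map g \<Gamma> (gradient_map g X) = X"
    if X: "X \<in> cone_quotient \<Gamma>" for X
  proof -
    obtain x where "x \<in> \<Gamma>" "X = x +o E" using X by (auto simp: cone_quotient_def)
    then show ?thesis
      by (simp add: gradient_map_coset gradient_in_open_polar dual_gradient_map_gradient)
  qed
  moreover have "dual_gradient_map g \<Gamma> y \<in> cone_quotient \<Gamma> \<and> gradient_map g (dual_gradient_map g \<Gamma> y) = y"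
    if y: "y \<in> open_polar \<Gamma>" for y
  proof -
    obtain x where "x \<in> \<Gamma>" "F x = y" using gradient_surjective[OF y] .
    then show ?thesis
      using dual_gradient_map_gradient[of x] gradient_map_coset[of x] by (auto simp: cone_quotient_def)
  qed
  ultimately show ?thesis by blast
qed

end
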